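(* Let $F:\ell^p\to Y$ be Fréchet differentiable on $\ell^p$ and suppose: (i) there is $L>0$ with $\|F'(x)-F'(z)\|_{\mathcal L(\ell^p,Y)}\le L\|x-z\|$ for all $x,z\in\ell^p$; (ii) there is $c>0$ with $\|F(x)-F(z)-F'(z)(x-z)\|\le c\,D_{f_p}(x,z)$ for all $x,z\in\ell^p$; (iii) there are $s>2$, $0<\varrho<\frac1{sc}$, an $f_p$-minimizing solution $x^\dagger$ and $\omega\in Y$ with $\|\omega\|\le\varrho$ and $J_p(x^\dagger)=F'(x^\dagger)^*\omega$. Let $\alpha_j\ge\alpha^*$ and $x_{j,0}\in\mathcal B_{d_{\alpha_j}}(x_{\alpha_j}^\delta)$. Then there is a constant $M_{\alpha_j}>0$ such that the sequence $\{x_{j,k}\}_{k\in\mathbb N_0}$ generated from $x_{j,0}$ by the dual iteration $$J_p(x_{j,k+1})=J_p(x_{j,k})-\beta_{j,k}\nabla\Phi_{\alpha_j}(x_{j,k}),\qquad x_{j,k+1}=J_q(J_p(x_{j,k+1})),$$ with step-sizes $$\beta_{j,k}=\min\left\{\frac{\gamma\,\bar c_{j,k}\,\alpha_j}{\|\nabla\Phi_{\alpha_j}(x_{j,k})\|^2},\ \frac1{2M_{\alpha_j}}\right\}$$ converges to the global minimizer $x_{\alpha_j}^\delta$ of $\Phi_{\alpha_j}$, i.e. $x_{j,k}\to x_{\alpha_j}^\delta$ in $\ell^p$ as $k\to\infty$.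
   Context: Fix $1<p\le2$ and $q$ with $\frac1p+\frac1q=1$. $\ell^p=\ell^p(\mathbb N)$ is the real sequence space with dual $\ell^q$ and duality product $\langle\cdot,\cdot\rangle$; $Y$ is a real Hilbert space; all norms are written $\|\cdot\|$. $F:\ell^p\to Y$ is a nonlinear operator that is sequentially closed with respect to the weak topologies of $\ell^p$ and $Y$. Let $y\in\mathrm{Rg}(F)$, $\delta>0$, and fix $y^\delta\in Y$ with $\|y-y^\delta\|\le\delta$. $f_p(x)=\frac1p\|x\|_{\ell^p}^p$; $J_p(x)=\nabla f_p(x)=(|x_i|^{p-1}\mathrm{sgn}(x_i))_{i}\in\ell^q$, with inverse $J_q:\ell^q\to\ell^p$, $J_q(\xi)=(|\xi_i|^{q-1}\mathrm{sgn}(\xi_i))_i$; Bregman distance $D_{f_p}(z,x)=f_p(z)-f_p(x)-\langle J_p(x),z-x\rangle$. An $f_p$-minimizing solution $x^\dagger$ is an element with $F(x^\dagger)=y$ and $f_p(x^\dagger)=\min\{f_p(x):F(x)=y\}$. $\tilde c_p>0$ is a constant such that $D_{f_p}(z,x)\le\tilde c_p\|x-z\|^p$ for all $x,z\in\ell^p$. For $\alpha>0$: $\Phi_\alpha(x)=\frac12\|F(x)-y^\delta\|^2+\frac{\alpha}{p}\|x\|_{\ell^p}^p$, $\nabla\Phi_\alpha(x)=F'(x)^*(F(x)-y^\delta)+\alpha J_p(x)\in\ell^q$, and $x_\alpha^\delta$ denotes a global minimizer of $\Phi_\alpha$ over $\ell^p$. With the constants of the claim: $\alpha^*:=\frac{\delta}{(s-2)\varrho}$,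 $A:=\left(\frac{p}{2\alpha^*}\right)^{1/p}\|F(0)-y^\delta\|^{2/p}$, $K:=LA+\|F'(0)\|$, $\gamma:=\frac{1-sc\varrho}{2}$, and for $\alpha\ge\alpha^*$, $r_\alpha:=\frac{2}{1+\sqrt2}\min\left\{\frac{\gamma\alpha}{3cK},\sqrt{\frac{\gamma\alpha}{10cL}}\right\}$ (with $\gamma\alpha/(3cK)$ read as $+\infty$ if $K=0$). Notation: $B_r(x)=\{z\in\ell^p:\|z-x\|\le r\}$ and $\mathcal B_d(z)=\{x\in\ell^p:D_{f_p}(z,x)\le d\}$. Fix a function $\alpha\mapsto d_\alpha>0$ on $[\alpha^*,\infty)$ that is continuous, strictly increasing, satisfies $d_\alpha\to\infty$ as $\alpha\to\infty$, and $\mathcal B_{d_\alpha}(x_\alpha^\delta)\subset B_{r_\alpha}(x_\alpha^\delta)$ for all $\alpha\ge\alpha^*$ (such a function exists). Step-size quantities: $\bar c_A:=\frac{p-1}{2}(2r_{\alpha_j}+A)^{p-2}$, $\phi_{j,k}:=\min\{\Phi_{\alpha_j}(J_q(J_p(x_{j,k})-t\nabla\Phi_{\alpha_j}(x_{j,k}))):t\ge0\}$, and $$\bar c_{j,k}:=\min\left\{1,\ \frac{8\bar c_A(\Phi_{\alpha_j}(x_{j,k})-\phi_{j,k})}{4K^2+4Ls\varrho\alpha_j+4LKr_{\alpha_j}+L^2r_{\alpha_j}^2+8\alpha_j\tilde c_p\bar c_A^{(2-p)/2}}\right\}.$$ If $\nabla\Phi_{\alpha_j}(x_{j,k})=0$,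 then $x_{j,k+1}=x_{j,k}$ and $\beta_{j,k}$ is irrelevant. *)

theory Defs
  imports "HOL-Analysis.Analysis" "HOL-Library.Function_Algebras"
begin

text \<open>
  The exponent of the sequence space varies, so it cannot be reflected in a type: elements are
  functions of type nat to real, with the pointwise operations, and the space is an explicit carrier.
  Nothing is assumed about the values of an operator outside of its carrier.
\<close>

definition lp :: "real \<Rightarrow> (nat \<Rightarrow> real) set" where
  "lp p = {x. summable (\<lambda>i. \<bar>x i\<bar> powr p)}"

definition lpnorm :: "real \<Rightarrow> (nat \<Rightarrow> real) \<Rightarrow> real" where
  "lpnorm p x = (\<Sum>i. \<bar>x i\<bar> powr p) powr (1 / p)"

definition lp_tendsto :: "real \<Rightarrow> (nat \<Rightarrow> nat \<Rightarrow> real) \<Rightarrow> (nat \<Rightarrow> real) \<Rightarrow> bool" where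
  "lp_tendsto p X x \<longleftrightarrow> (\<forall>n. X n \<in> lp p) \<and> x \<in> lp p \<and> (\<lambda>n. lpnorm p (X n - x)) \<longlonglongrightarrow> 0"

definition lp_cball :: "real \<Rightarrow> (nat \<Rightarrow> real) \<Rightarrow> real \<Rightarrow> (nat \<Rightarrow> real) set" where
  "lp_cball p x r = {z \<in> lp p. lpnorm p (z - x) \<le> r}"

definition pairing :: "(nat \<Rightarrow> real) \<Rightarrow> (nat \<Rightarrow> real) \<Rightarrow> real" where
  "pairing \<xi> x = (\<Sum>i. \<xi> i * x i)"

definition duality_map :: "real \<Rightarrow> (nat \<Rightarrow> real) \<Rightarrow> nat \<Rightarrow> real" where
  "duality_map p x = (\<lambda>i. \<bar>x i\<bar> powr (p - 1) * sgn (x i))"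

definition fp :: "real \<Rightarrow> (nat \<Rightarrow> real) \<Rightarrow> real" where
  "fp p x = 1 / p * lpnorm p x powr p"

definition bregman :: "real \<Rightarrow> (nat \<Rightarrow> real) \<Rightarrow> (nat \<Rightarrow> real) \<Rightarrow> real" where
  "bregman p z x = fp p z - fp p x - pairing (duality_map p x) (z - x)"

text \<open>The centre \<^term>\<open>z\<close> is the first argument of the (unsymmetric) Bregman distance.\<close>

definition bregman_ball :: "real \<Rightarrow> (nat \<Rightarrow> real) \<Rightarrow> real \<Rightarrow> (nat \<Rightarrow> real) set" where
  "bregman_ball p z d = {x \<in> lp p. bregman p z x \<le> d}"

definition lp_bounded_linear :: "real \<Rightarrow> ((nat \<Rightarrow> real) \<Rightarrow> 'y::real_normed_vector) \<Rightarrow> bool" where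
  "lp_bounded_linear p T \<longleftrightarrow>
     (\<forall>x\<in>lp p. \<forall>z\<in>lp p. T (x + z) = T x + T z) \<and>
     (\<forall>a. \<forall>x\<in>lp p. T (\<lambda>i. a * x i) = a *\<^sub>R T x) \<and>
     (\<exists>C. \<forall>x\<in>lp p. norm (T x) \<le> C * lpnorm p x)"

definition lp_opnorm :: "real \<Rightarrow> ((nat \<Rightarrow> real) \<Rightarrow> 'y::real_normed_vector) \<Rightarrow> real" where
  "lp_opnorm p T = Sup {norm (T h) |h. h \<in> lp p \<and> lpnorm p h \<le> 1}"

definition lp_frechet ::
  "real \<Rightarrow> ((nat \<Rightarrow> real) \<Rightarrow> 'y::real_normed_vector) \<Rightarrow> ((nat \<Rightarrow> real) \<Rightarrow> 'y) \<Rightarrow> (nat \<Rightarrow> real) \<Rightarrow> bool"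
  where
  "lp_frechet p F T x \<longleftrightarrow> lp_bounded_linear p T \<and>
     (\<forall>\<epsilon>>0. \<exists>\<eta>>0. \<forall>h\<in>lp p. lpnorm p h \<le> \<eta> \<longrightarrow> norm (F (x + h) - F x - T h) \<le> \<epsilon> * lpnorm p h)"

text \<open>
  The adjoint of an operator from the space with exponent \<^term>\<open>p\<close> to a Hilbert space, whose dual is
  identified with itself; \<^term>\<open>q\<close> is the conjugate exponent.
\<close>

definition lp_adjoint ::
  "real \<Rightarrow> real \<Rightarrow> ((nat \<Rightarrow> real) \<Rightarrow> 'y::real_inner) \<Rightarrow> 'y \<Rightarrow> nat \<Rightarrow> real" where
  "lp_adjoint p q T w = (THE \<xi>. \<xi> \<in> lp q \<and> (\<forall>h\<in>lp p. pairing \<xi> h = w \<bullet> T h))"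

definition weakly_seq_closed ::
  "real \<Rightarrow> real \<Rightarrow> ((nat \<Rightarrow> real) \<Rightarrow> 'y::real_inner) \<Rightarrow> bool" where
  "weakly_seq_closed p q F \<longleftrightarrow>
     (\<forall>X x v. (\<forall>n. X n \<in> lp p) \<and> x \<in> lp p \<and>
        (\<forall>\<xi>\<in>lp q. (\<lambda>n. pairing \<xi> (X n)) \<longlonglongrightarrow> pairing \<xi> x) \<and>
        (\<forall>w. (\<lambda>n. w \<bullet> F (X n)) \<longlonglongrightarrow> w \<bullet> v)
        \<longrightarrow> F x = v)"

definition fp_minimizing_solution ::
  "real \<Rightarrow> ((nat \<Rightarrow> real) \<Rightarrow> 'y) \<Rightarrow> 'y \<Rightarrow> (nat \<Rightarrow> real) \<Rightarrow> bool" where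
  "fp_minimizing_solution p F y x \<longleftrightarrow>
     x \<in> lp p \<and> F x = y \<and> (\<forall>z\<in>lp p. F z = y \<longrightarrow> fp p x \<le> fp p z)"

definition tikhonov ::
  "real \<Rightarrow> ((nat \<Rightarrow> real) \<Rightarrow> 'y::real_inner) \<Rightarrow> 'y \<Rightarrow> real \<Rightarrow> (nat \<Rightarrow> real) \<Rightarrow> real" where
  "tikhonov p F yd \<alpha> x = 1 / 2 * norm (F x - yd) ^ 2 + \<alpha> / p * lpnorm p x powr p"

definition tikhonov_grad ::
  "real \<Rightarrow> real \<Rightarrow> ((nat \<Rightarrow> real) \<Rightarrow> 'y::real_inner) \<Rightarrow> ((nat \<Rightarrow> real) \<Rightarrow> (nat \<Rightarrow> real) \<Rightarrow> 'y) \<Rightarrow>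
   'y \<Rightarrow> real \<Rightarrow> (nat \<Rightarrow> real) \<Rightarrow> nat \<Rightarrow> real" where
  "tikhonov_grad p q F F' yd \<alpha> x =
     (\<lambda>i. lp_adjoint p q (F' x) (F x - yd) i + \<alpha> * duality_map p x i)"

definition tikhonov_minimizer ::
  "real \<Rightarrow> ((nat \<Rightarrow> real) \<Rightarrow> 'y::real_inner) \<Rightarrow> 'y \<Rightarrow> real \<Rightarrow> (nat \<Rightarrow> real) \<Rightarrow> bool" where
  "tikhonov_minimizer p F yd \<alpha> x \<longleftrightarrow>
     x \<in> lp p \<and> (\<forall>z\<in>lp p. tikhonov p F yd \<alpha> x \<le> tikhonov p F yd \<alpha> z)"

text \<open>
  One step in the dual space from \<^term>\<open>x\<close> along \<^term>\<open>g\<close>, mapped back; note that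
  \<^term>\<open>duality_map q\<close> is the inverse of \<^term>\<open>duality_map p\<close>.
\<close>

definition dual_step ::
  "real \<Rightarrow> real \<Rightarrow> (nat \<Rightarrow> real) \<Rightarrow> real \<Rightarrow> (nat \<Rightarrow> real) \<Rightarrow> nat \<Rightarrow> real" where
  "dual_step p q g t x = duality_map q (\<lambda>i. duality_map p x i - t * g i)"

text \<open>
  The minimum along the dual ray. The functional is nonnegative, so the infimum is that of a nonempty
  set bounded below; it is attained, by continuity and coercivity (trivially if the gradient is zero).
\<close>

definition line_min ::
  "real \<Rightarrow> real \<Rightarrow> ((nat \<Rightarrow> real) \<Rightarrow> 'y::real_inner) \<Rightarrow> ((nat \<Rightarrow> real) \<Rightarrow> (nat \<Rightarrow> real) \<Rightarrow> 'y) \<Rightarrow>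
   'y \<Rightarrow> real \<Rightarrow> (nat \<Rightarrow> real) \<Rightarrow> real" where
  "line_min p q F F' yd \<alpha> x =
     (INF t\<in>{0..}. tikhonov p F yd \<alpha> (dual_step p q (tikhonov_grad p q F F' yd \<alpha> x) t x))"

primrec dual_iterates ::
  "real \<Rightarrow> real \<Rightarrow> ((nat \<Rightarrow> real) \<Rightarrow> nat \<Rightarrow> real) \<Rightarrow> ((nat \<Rightarrow> real) \<Rightarrow> real) \<Rightarrow>
   (nat \<Rightarrow> real) \<Rightarrow> nat \<Rightarrow> nat \<Rightarrow> real" where
  "dual_iterates p q g \<beta> x0 0 = x0"
| "dual_iterates p q g \<beta> x0 (Suc k) =
     (let x = dual_iterates p q g \<beta> x0 k in dual_step p q (g x) (\<beta> x) x)"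

end

theory Submission
  imports Defs
begin

text \<open>
  The iteration is mirror descent with mirror map \<open>f\<^sub>p\<close>. Although \<open>\<nabla>\<Phi>\<^sub>\<alpha>\<close> is only Hoelder continuous,
  on bounded sets \<open>\<Phi>\<^sub>\<alpha>\<close> is smooth relative to \<open>f\<^sub>p\<close>: the linearization error of \<open>F\<close> is bounded by the
  Bregman distance, and so is the square of the norm, by the convexity of power type 2 of \<open>\<ell>\<^sup>p\<close>. The source
  condition bounds \<open>c \<parallel>F(x\<^sub>\<alpha>) - y\<^sup>\<delta>\<parallel>\<close> by \<open>(1 - 2\<gamma>)\<alpha>\<close>, and the choice of the radius then gives
  \<open>\<langle>\<nabla>\<Phi>(x), x - x\<^sub>\<alpha>\<rangle> \<ge> \<Phi>(x) - \<Phi>(x\<^sub>\<alpha>) + \<gamma>\<alpha> D(x\<^sub>\<alpha>, x)\<close> on the ball. Together with the three-point identity,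
  a step of size \<open>t \<le> 1/(2M)\<close> satisfies \<open>D(x\<^sub>\<alpha>, x\<^sup>+) \<le> (1 - t\<gamma>\<alpha>) D(x\<^sub>\<alpha>, x)\<close> once \<open>M\<close> is large. If the Bregman
  distances stayed above some \<open>\<epsilon> > 0\<close>, the gradients, the decrease along the dual ray and hence the
  step sizes would be bounded away from zero, which is impossible.
\<close>

section \<open>The sequence spaces and their duality\<close>

text \<open>Young's inequality is applied termwise to the normalized sequences \<open>u / U\<close>
  and \<open>v / V\<close>, whose sums are 1. The exponents \<theta> and 1 - \<theta> cover both
  later uses: \<theta> = 1/q for the duality pairing, and \<theta> = p/2 for the convexity estimate,
  where p = 2 is the endpoint.\<close>

lemma weighted_Holder:
  fixes u v :: "nat \<Rightarrow> real"
  assumes \<theta>: "0 \<le> \<theta>" "\<theta> \<le> 1"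
    and u: "\<And>i. 0 \<le> u i" "summable u" and v: "\<And>i. 0 \<le> v i" "summable v"
  shows "summable (\<lambda>i. u i powr \<theta> * v i powr (1 - \<theta>))"
    and "(\<Sum>i. u i powr \<theta> * v i powr (1 - \<theta>)) \<le> (\<Sum>i. u i) powr \<theta> * (\<Sum>i. v i) powr (1 - \<theta>)"
proof -
  define U V where "U = (\<Sum>i. u i)" and "V = (\<Sum>i. v i)"
  have UV0: "U \<ge> 0" "V \<ge> 0"
    using u v by (auto simp: U_def V_def intro: suminf_nonneg)
  have "summable (\<lambda>i. u i powr \<theta> * v i powr (1 - \<theta>)) \<and>
      (\<Sum>i. u i powr \<theta> * v i powr (1 - \<theta>)) \<le> U powr \<theta> * V powr (1 - \<theta>)"
  proof (cases "U = 0 \<or> V = 0")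
    case True
    then have "(\<forall>i. u i = 0) \<or> (\<forall>i. v i = 0)"
      using suminf_eq_zero_iff[OF u(2,1)] suminf_eq_zero_iff[OF v(2,1)] by (auto simp: U_def V_def)
    then have "(\<lambda>i. u i powr \<theta> * v i powr (1 - \<theta>)) = (\<lambda>i. 0)"
      by auto
    then show ?thesis
      by (simp only:) simp
  next
    case False
    then have UV: "U > 0" "V > 0"
      using UV0 by auto
    have le: "u i powr \<theta> * v i powr (1 - \<theta>) \<le> U powr \<theta> * V powr (1 - \<theta>) * (\<theta> / U * u i + (1 - \<theta>) / V * v i)" for i
    proof (cases "u i = 0 \<or> v i = 0")
      case True
      then show ?thesis
        using UV \<theta> u(1)[of i] v(1)[of i] by auto
    next
      case False
      then have "(u i / U) powr \<theta> * (v i / V) powr (1 - \<theta>) \<le> \<theta> * (u i / U) + (1 - \<theta>) * (v i / V)"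
        using UV u(1)[of i] v(1)[of i] \<theta> by (intro Youngs_inequality_0) auto
      then have "U powr \<theta> * V powr (1 - \<theta>) * ((u i / U) powr \<theta> * (v i / V) powr (1 - \<theta>))
          \<le> U powr \<theta> * V powr (1 - \<theta>) * (\<theta> * (u i / U) + (1 - \<theta>) * (v i / V))"
        by (intro mult_left_mono) auto
      moreover have "U powr \<theta> * V powr (1 - \<theta>) * ((u i / U) powr \<theta> * (v i / V) powr (1 - \<theta>))
          = u i powr \<theta> * v i powr (1 - \<theta>)"
        using UV by (simp add: powr_divide)
      ultimately show ?thesis
        by simp
    qed
    have sm: "summable (\<lambda>i. U powr \<theta> * V powr (1 - \<theta>) * (\<theta> / U * u i + (1 - \<theta>) / V * v i))"
      by (intro summable_mult summable_add u v)
    have s1: "summable (\<lambda>i. u i powr \<theta> * v i powr (1 - \<theta>))"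
      by (rule summable_comparison_test_ev[OF _ sm]) (use le in auto)
    have "(\<Sum>i. u i powr \<theta> * v i powr (1 - \<theta>))
        \<le> (\<Sum>i. U powr \<theta> * V powr (1 - \<theta>) * (\<theta> / U * u i + (1 - \<theta>) / V * v i))"
      by (intro suminf_le le s1 sm)
    also have "\<dots> = U powr \<theta> * V powr (1 - \<theta>) * (\<theta> / U * U + (1 - \<theta>) / V * V)"
      unfolding U_def V_def
      by (intro sums_unique[symmetric] sums_mult sums_add summable_sums u v)
    also have "\<dots> = U powr \<theta> * V powr (1 - \<theta>)"
      using UV by simp
    finally show ?thesis
      using s1 by simp
  qed
  then show "summable (\<lambda>i. u i powr \<theta> * v i powr (1 - \<theta>))"
    and "(\<Sum>i. u i powr \<theta> * v i powr (1 - \<theta>)) \<le> (\<Sum>i. u i) powr \<theta> * (\<Sum>i. v i) powr (1 - \<theta>)"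
    by (auto simp: U_def V_def)
qed

text \<open>The second derivative test gives convexity on the open half-line only. If an argument
  vanishes, \<open>le\<close> takes over, which rests on s^p \<le> s for s in [0, 1].\<close>

lemma powr_convex:
  fixes a b t p :: real
  assumes "p \<ge> 1" "a \<ge> 0" "b \<ge> 0" "0 \<le> t" "t \<le> 1"
  shows "(t * a + (1 - t) * b) powr p \<le> t * a powr p + (1 - t) * b powr p"
proof -
  have conv: "convex_on {0<..} (\<lambda>x::real. x powr p)"
    using assms(1)
    by (intro f''_ge0_imp_convex[where f' = "\<lambda>x. p * x powr (p - 1)" and f'' = "\<lambda>x. p * ((p - 1) * x powr (p - 1 - 1))"])
       (auto intro!: derivative_eq_intros)
  have le: "s * x powr p \<ge> (s * x) powr p" if "0 \<le> s" "s \<le> 1" "x \<ge> 0" for s x :: real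
  proof (cases "s = 0")
    case False
    then have "s powr p \<le> s powr 1"
      using that assms(1) by (intro powr_mono') auto
    then have "s powr p \<le> s"
      using that by simp
    then show ?thesis
      using that by (simp add: powr_mult mult_right_mono)
  qed auto
  show ?thesis
  proof (cases "a = 0 \<or> b = 0")
    case True
    then show ?thesis
      using le[of t a] le[of "1 - t" b] assms by auto
  next
    case False
    then show ?thesis
      using convex_onD[OF conv, of "1 - t" a b] assms by (simp add: algebra_simps)
  qed
qed

text \<open>A number in [0, 1] does not decrease when raised to a power t \<le> 1. This is applied
  to the shares a / (a + b) and b / (a + b), which add up to 1.\<close>

lemma powr_subadditive:
  fixes a b t :: real
  assumes t: "0 < t" "t \<le> 1" and ab: "a \<ge> 0" "b \<ge> 0"
  shows "(a + b) powr t \<le> a powr t + b powr t"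
proof (cases "a + b = 0")
  case False
  then have pos: "a + b > 0"
    using ab by simp
  have *: "x / (a + b) \<le> (x / (a + b)) powr t" if "0 \<le> x" "x \<le> a + b" for x
    using powr_mono'[of t 1 "x / (a + b)"] t that pos by (cases "x = 0") auto
  have "1 = a / (a + b) + b / (a + b)"
    using pos by (simp add: add_divide_distrib[symmetric])
  also have "\<dots> \<le> (a / (a + b)) powr t + (b / (a + b)) powr t"
    using ab by (intro add_mono *) auto
  finally show ?thesis
    using pos ab by (simp add: powr_divide add_divide_distrib[symmetric])
qed auto

lemma lpnorm_nonneg [simp]: "0 \<le> lpnorm p x"
  by (simp add: lpnorm_def)

lemma lpnorm_powr:
  assumes "p > 0" "x \<in> lp p"
  shows "lpnorm p x powr p = (\<Sum>i. \<bar>x i\<bar> powr p)"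
proof -
  have "(\<Sum>i. \<bar>x i\<bar> powr p) \<ge> 0"
    using assms by (intro suminf_nonneg) (auto simp: lp_def)
  then show ?thesis
    using assms by (simp add: lpnorm_def powr_powr)
qed

lemma lpnorm_le:
  assumes "p > 0" "(\<Sum>i. \<bar>x i\<bar> powr p) \<le> C powr p" "C \<ge> 0" "x \<in> lp p"
  shows "lpnorm p x \<le> C"
proof -
  have "(\<Sum>i. \<bar>x i\<bar> powr p) \<ge> 0"
    using assms by (intro suminf_nonneg) (auto simp: lp_def)
  then have "lpnorm p x \<le> (C powr p) powr (1 / p)"
    unfolding lpnorm_def using assms by (intro powr_mono2) auto
  then show ?thesis
    using assms by (simp add: powr_powr)
qed

lemma lpnorm_eq_0_iff:
  assumes "p > 0" "x \<in> lp p"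
  shows "lpnorm p x = 0 \<longleftrightarrow> x = 0"
  using assms suminf_eq_zero_iff[of "\<lambda>i. \<bar>x i\<bar> powr p"] by (auto simp: lpnorm_def lp_def fun_eq_iff)

lemma lp_scale [intro]: "x \<in> lp p \<Longrightarrow> (\<lambda>i. a * x i) \<in> lp p"
  by (auto simp: lp_def abs_mult powr_mult intro: summable_mult)

lemma lp_uminus: "x \<in> lp p \<Longrightarrow> - x \<in> lp p"
  by (auto simp: lp_def)

lemma lp_zero [simp, intro]: "0 \<in> lp p"
  by (auto simp: lp_def)

lemma lpnorm_zero [simp]: "lpnorm p 0 = 0"
  by (simp add: lpnorm_def)

lemma lpnorm_minus_commute: "lpnorm p (x - z) = lpnorm p (z - x)"
  by (simp add: lpnorm_def abs_minus_commute)

lemma lpnorm_scale: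
  assumes "p > 0" "x \<in> lp p"
  shows "lpnorm p (\<lambda>i. a * x i) = \<bar>a\<bar> * lpnorm p x"
proof -
  have "(\<Sum>i. \<bar>a * x i\<bar> powr p) = \<bar>a\<bar> powr p * (\<Sum>i. \<bar>x i\<bar> powr p)"
    using assms by (simp add: abs_mult powr_mult lp_def suminf_mult)
  then show ?thesis
    using assms by (simp add: lpnorm_def powr_mult powr_powr)
qed

text \<open>With X and Z the norms, \<bar>x i\<bar> + \<bar>z i\<bar> is X + Z times the convex
  combination of \<bar>x i\<bar> / X and \<bar>z i\<bar> / Z with weights X / (X + Z) and Z / (X +
  Z). Convexity of the power, summed over i, yields membership and the triangle inequality at
  once.\<close>

lemma lp_add_Minkowski:
  assumes p: "p \<ge> 1" and x: "x \<in> lp p" and z: "z \<in> lp p"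
  shows "x + z \<in> lp p" and "lpnorm p (x + z) \<le> lpnorm p x + lpnorm p z"
proof -
  have "x + z \<in> lp p \<and> lpnorm p (x + z) \<le> lpnorm p x + lpnorm p z"
  proof (cases "lpnorm p x = 0 \<or> lpnorm p z = 0")
    case True
    then show ?thesis
      using assms lpnorm_eq_0_iff[of p x] lpnorm_eq_0_iff[of p z] by auto
  next
    case False
    define X Z where "X = lpnorm p x" and "Z = lpnorm p z"
    have pos: "X > 0" "Z > 0"
      using False lpnorm_nonneg[of p x] lpnorm_nonneg[of p z] unfolding X_def Z_def by linarith+
    define t where "t = X / (X + Z)"
    have t: "0 \<le> t" "t \<le> 1" "1 - t = Z / (X + Z)"
      using pos by (auto simp: t_def field_simps)
    have le: "\<bar>x i + z i\<bar> powr p \<le> (X + Z) powr p * (t / X powr p * \<bar>x i\<bar> powr p + (1 - t) / Z powr p * \<bar>z i\<bar> powr p)" for i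
    proof -
      have "(X + Z) * (t * (\<bar>x i\<bar> / X) + (1 - t) * (\<bar>z i\<bar> / Z)) = \<bar>x i\<bar> + \<bar>z i\<bar>"
        using pos add_pos_pos[OF pos] unfolding t(3) by (simp add: t_def distrib_left)
      then have "\<bar>x i + z i\<bar> \<le> (X + Z) * (t * (\<bar>x i\<bar> / X) + (1 - t) * (\<bar>z i\<bar> / Z))"
        by (metis abs_triangle_ineq)
      then have "\<bar>x i + z i\<bar> powr p \<le> ((X + Z) * (t * (\<bar>x i\<bar> / X) + (1 - t) * (\<bar>z i\<bar> / Z))) powr p"
        using p by (intro powr_mono2) auto
      also have "\<dots> = (X + Z) powr p * (t * (\<bar>x i\<bar> / X) + (1 - t) * (\<bar>z i\<bar> / Z)) powr p"
        by (simp add: powr_mult)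
      also have "\<dots> \<le> (X + Z) powr p * (t * (\<bar>x i\<bar> / X) powr p + (1 - t) * (\<bar>z i\<bar> / Z) powr p)"
        using t pos p by (intro mult_left_mono powr_convex) auto
      finally show ?thesis
        by (simp add: powr_divide)
    qed
    have sx: "summable (\<lambda>i. \<bar>x i\<bar> powr p)" and sz: "summable (\<lambda>i. \<bar>z i\<bar> powr p)"
      using x z by (auto simp: lp_def)
    have sm: "summable (\<lambda>i. (X + Z) powr p * (t / X powr p * \<bar>x i\<bar> powr p + (1 - t) / Z powr p * \<bar>z i\<bar> powr p))"
      by (intro summable_mult summable_add sx sz)
    have s: "summable (\<lambda>i. \<bar>x i + z i\<bar> powr p)"
      by (rule summable_comparison_test_ev[OF _ sm]) (use le in auto)
    have "(\<Sum>i. \<bar>x i + z i\<bar> powr p) \<le>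
        (\<Sum>i. (X + Z) powr p * (t / X powr p * \<bar>x i\<bar> powr p + (1 - t) / Z powr p * \<bar>z i\<bar> powr p))"
      by (intro suminf_le le s sm)
    also have "\<dots> = (X + Z) powr p * (t / X powr p * X powr p + (1 - t) / Z powr p * Z powr p)"
      using p x z
      by (intro sums_unique[symmetric] sums_mult sums_add)
         (auto simp: X_def Z_def lpnorm_powr intro: summable_sums sx sz)
    also have "\<dots> = (X + Z) powr p"
      using pos by simp
    finally show ?thesis
      using s pos p unfolding X_def Z_def
      by (auto simp: lp_def intro!: lpnorm_le)
  qed
  then show "x + z \<in> lp p" and "lpnorm p (x + z) \<le> lpnorm p x + lpnorm p z"
    by auto
qed

lemma lp_diff_Minkowski:
  assumes p: "p \<ge> 1" and x: "x \<in> lp p" and z: "z \<in> lp p"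
  shows "x - z \<in> lp p" and "lpnorm p (x - z) \<le> lpnorm p x + lpnorm p z"
proof -
  have eq: "x - z = x + (- z)" and n: "lpnorm p (- z) = lpnorm p z"
    by (simp_all add: lpnorm_def fun_eq_iff)
  show "x - z \<in> lp p" and "lpnorm p (x - z) \<le> lpnorm p x + lpnorm p z"
    using lp_add_Minkowski[OF p x lp_uminus[OF z]] n unfolding eq by auto
qed

lemma lpnorm_le_add_diff:
  assumes "p \<ge> 1" "x \<in> lp p" "z \<in> lp p"
  shows "lpnorm p x \<le> lpnorm p z + lpnorm p (x - z)"
  using lp_add_Minkowski(2)[OF assms(1,3) lp_diff_Minkowski(1)[OF assms]] by simp

lemma duality_map_abs: "\<bar>duality_map p x i\<bar> = \<bar>x i\<bar> powr (p - 1)"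
  by (auto simp: duality_map_def abs_mult sgn_if)

section \<open>Conjugate exponents, duality maps and Hoelder's inequality\<close>

locale conjugate_exponents =
  fixes p q :: real
  assumes p1: "1 < p" and p2: "p \<le> 2" and conj: "1 / p + 1 / q = 1"
begin

lemma q_ge: "2 \<le> q"
proof -
  have eq: "1 / q = (p - 1) / p"
    using conj p1 by (simp add: diff_divide_distrib)
  then have "q = p / (p - 1)"
    by (metis inverse_eq_divide inverse_inverse_eq inverse_divide)
  then show ?thesis
    using p1 p2 by (simp add: pos_le_divide_eq)
qed

lemma pq: "q * (p - 1) = p" "p * (q - 1) = q"
  using conj p1 q_ge by (auto simp: field_simps)

lemma pq_swap: "(p - 1) * (q - 1) = 1"
  using pq by (simp add: algebra_simps)

lemma exponents: "1 / p * (p - 1) = 1 / q" "1 / q * (q - 1) = 1 / p"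
  using conj p1 q_ge by (auto simp: field_simps)

lemma duality_map_lp:
  assumes "x \<in> lp p"
  shows "duality_map p x \<in> lp q" and "lpnorm q (duality_map p x) = lpnorm p x powr (p - 1)"
proof -
  have "(\<lambda>i. \<bar>duality_map p x i\<bar> powr q) = (\<lambda>i. \<bar>x i\<bar> powr p)"
    using pq by (simp add: duality_map_abs powr_powr mult.commute)
  then show "duality_map p x \<in> lp q" "lpnorm q (duality_map p x) = lpnorm p x powr (p - 1)"
    using assms exponents by (auto simp: lp_def lpnorm_def powr_powr)
qed

lemma duality_map_lq:
  assumes "\<xi> \<in> lp q"
  shows "duality_map q \<xi> \<in> lp p" and "lpnorm p (duality_map q \<xi>) = lpnorm q \<xi> powr (q - 1)"
proof -
  have "(\<lambda>i. \<bar>duality_map q \<xi> i\<bar> powr p) = (\<lambda>i. \<bar>\<xi> i\<bar> powr q)"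
    using pq by (simp add: duality_map_abs powr_powr mult.commute)
  then show "duality_map q \<xi> \<in> lp p" "lpnorm p (duality_map q \<xi>) = lpnorm q \<xi> powr (q - 1)"
    using assms exponents by (auto simp: lp_def lpnorm_def powr_powr)
qed

lemma duality_map_inverse: "duality_map q (duality_map p x) = x"
    "duality_map p (duality_map q x) = x"
proof -
  \<comment> \<open>Real \<open>powr\<close> sees only the absolute value of its base, so the
    identities hold for either sign of \<open>a\<close>; the factor \<open>sgn\<close> restores the
    sign afterwards.\<close>
  have "(a powr (p - 1)) powr (q - 1) = \<bar>a\<bar>" "(a powr (q - 1)) powr (p - 1) = \<bar>a\<bar>" for a :: real
    by (simp_all only: powr_powr pq_swap mult.commute[of "q - 1" "p - 1"] powr_one')
  then show "duality_map q (duality_map p x) = x" "duality_map p (duality_map q x) = x"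
    by (auto simp: duality_map_def fun_eq_iff abs_mult sgn_if)
qed

lemma pairing_Holder:
  assumes "\<xi> \<in> lp q" "x \<in> lp p"
  shows "summable (\<lambda>i. \<xi> i * x i)" and "\<bar>pairing \<xi> x\<bar> \<le> lpnorm q \<xi> * lpnorm p x"
proof -
  have eq: "(\<bar>\<xi> i\<bar> powr q) powr (1 / q) * (\<bar>x i\<bar> powr p) powr (1 - 1 / q) = \<bar>\<xi> i * x i\<bar>" for i
  proof -
    have "1 - 1 / q = 1 / p" using conj by simp
    then show ?thesis
      using p1 q_ge by (simp add: powr_powr abs_mult)
  qed
  have "0 \<le> 1 / q" "1 / q \<le> 1"
    using q_ge by auto
  note H = weighted_Holder[OF this, of "\<lambda>i. \<bar>\<xi> i\<bar> powr q" "\<lambda>i. \<bar>x i\<bar> powr p", unfolded eq]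
  have s: "summable (\<lambda>i. \<bar>\<xi> i * x i\<bar>)"
    using H(1) assms by (auto simp: lp_def)
  then show "summable (\<lambda>i. \<xi> i * x i)"
    by (rule summable_rabs_cancel)
  have "\<bar>pairing \<xi> x\<bar> \<le> (\<Sum>i. \<bar>\<xi> i * x i\<bar>)"
    unfolding pairing_def using s by (rule summable_rabs)
  also have "\<dots> \<le> lpnorm q \<xi> * lpnorm p x"
  proof -
    have "1 - 1 / q = 1 / p" using conj by simp
    then show ?thesis
      using H(2) assms by (auto simp: lp_def lpnorm_def)
  qed
  finally show "\<bar>pairing \<xi> x\<bar> \<le> lpnorm q \<xi> * lpnorm p x" .
qed

lemma pairing_diff_right:
  "\<xi> \<in> lp q \<Longrightarrow> x \<in> lp p \<Longrightarrow> z \<in> lp p \<Longrightarrow> pairing \<xi> (x - z) = pairing \<xi> x - pairing \<xi> z"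
  using suminf_diff[OF pairing_Holder(1)[of \<xi> x] pairing_Holder(1)[of \<xi> z]]
  by (simp add: pairing_def algebra_simps)

lemma pairing_lincomb_left:
  assumes "\<xi> \<in> lp q" "\<eta> \<in> lp q" "x \<in> lp p"
  shows "pairing (\<lambda>i. \<xi> i + a * \<eta> i) x = pairing \<xi> x + a * pairing \<eta> x"
  using suminf_add[OF pairing_Holder(1)[of \<xi> x] summable_mult[OF pairing_Holder(1)[of \<eta> x], of a]]
    suminf_mult[OF pairing_Holder(1)[of \<eta> x], of a] assms
  by (simp add: pairing_def algebra_simps)

end

section \<open>Convexity of power type two\<close>

lemma has_real_derivative_abs_powr:
  fixes p t :: real
  assumes p: "1 < p"
  shows "((\<lambda>t. \<bar>t\<bar> powr p / p) has_real_derivative \<bar>t\<bar> powr (p - 1) * sgn t) (at t)"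
proof (cases t "0 :: real" rule: linorder_cases)
  case less
  have "((\<lambda>t. (- t) powr p / p) has_real_derivative \<bar>t\<bar> powr (p - 1) * sgn t) (at t)"
    using less p by (auto intro!: derivative_eq_intros)
  moreover have "\<forall>\<^sub>F s in nhds t. (- s) powr p / p = \<bar>s\<bar> powr p / p"
    using less by (intro eventually_mono[OF eventually_nhds_in_open[of "{..<0}"]]) auto
  ultimately show ?thesis
    by (rule iffD1[OF DERIV_cong_ev[OF refl _ refl], rotated])
next
  case greater
  have "((\<lambda>t. t powr p / p) has_real_derivative \<bar>t\<bar> powr (p - 1) * sgn t) (at t)"
    using greater p by (auto intro!: derivative_eq_intros)
  moreover have "\<forall>\<^sub>F s in nhds t. s powr p / p = \<bar>s\<bar> powr p / p"
    using greater by (intro eventually_mono[OF eventually_nhds_in_open[of "{0<..}"]]) auto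
  ultimately show ?thesis
    by (rule iffD1[OF DERIV_cong_ev[OF refl _ refl], rotated])
next
  case equal
  \<comment> \<open>At the origin the difference quotient is exactly this expression, and it tends
    to 0 because p - 1 > 0.\<close>
  have "((\<lambda>h::real. \<bar>h\<bar> powr (p - 1) * sgn h / p) \<longlongrightarrow> 0) (at 0)"
  proof (rule tendsto_rabs_zero_cancel, rule Lim_null_comparison)
    show "\<forall>\<^sub>F h in at 0. norm \<bar>\<bar>h\<bar> powr (p - 1) * sgn h / p\<bar> \<le> \<bar>h\<bar> powr (p - 1)"
      using p by (intro always_eventually)
        (auto simp: abs_mult sgn_if divide_le_eq mult_le_cancel_left1)
    show "((\<lambda>h::real. \<bar>h\<bar> powr (p - 1)) \<longlongrightarrow> 0) (at 0)"
      using p by (intro tendsto_zero_powrI[where b = "p - 1"] tendsto_intros tendsto_rabs_zero) auto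
  qed
  moreover have "(\<bar>0 + h\<bar> powr p / p - \<bar>0\<bar> powr p / p) / h = \<bar>h\<bar> powr (p - 1) * sgn h / p" for h :: real
    by (cases "h = 0") (auto simp: powr_diff sgn_if)
  ultimately show ?thesis
    using equal by (simp add: DERIV_def)
qed

text \<open>Since p \<le> 2, the derivative (p - 1) \<bar>t\<bar>^(p - 2) is at least (p - 1) m^(p -
  2) away from 0 on [-m, m]. As it may blow up at 0, the mean value theorem is used only strictly
  inside a half-line; intervals ending at 0 are treated directly by \<open>zero\<close>, and an
  interval across 0 is split there.\<close>

lemma signed_powr_mono:
  fixes p m s t :: real
  assumes p: "1 < p" "p \<le> 2" and st: "s \<le> t" "\<bar>s\<bar> \<le> m" "\<bar>t\<bar> \<le> m"
  shows "(p - 1) * m powr (p - 2) * (t - s) \<le> \<bar>t\<bar> powr (p - 1) * sgn t - \<bar>s\<bar> powr (p - 1) * sgn s"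
proof (cases "m = 0")
  case True
  then have "s = 0" "t = 0" using st by auto
  then show ?thesis by simp
next
  case False
  then have m: "m > 0" using st by auto
  have zero: "(p - 1) * m powr (p - 2) * t \<le> t powr (p - 1)" if "0 \<le> t" "t \<le> m" for t
  proof (cases "t = 0")
    case False
    then have t: "t > 0" using that by simp
    have "(p - 1) * m powr (p - 2) * t \<le> 1 * t powr (p - 2) * t"
      using p that t m by (intro mult_mono powr_mono2') auto
    also have "\<dots> = t powr (p - 1)"
      using powr_mult_base[of t "p - 2"] t by (simp add: mult.commute algebra_simps)
    finally show ?thesis .
  qed auto
  have pos: "(p - 1) * m powr (p - 2) * (t - s) \<le> t powr (p - 1) - s powr (p - 1)"
    if "0 \<le> s" "s \<le> t" "t \<le> m" for s t
  proof (cases "s = 0 \<or> s = t")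
    case True
    then show ?thesis using zero[of t] that by auto
  next
    case False
    then have "s < t" "s > 0" using that by auto
    then have "\<exists>z>s. z < t \<and> t powr (p - 1) - s powr (p - 1) = (t - s) * ((p - 1) * z powr (p - 1 - 1))"
      by (intro MVT2) (auto intro!: derivative_eq_intros)
    then obtain z where z: "s < z" "z < t"
      "t powr (p - 1) - s powr (p - 1) = (t - s) * ((p - 1) * z powr (p - 2))"
      by auto
    have "m powr (p - 2) \<le> z powr (p - 2)"
      using p z that by (intro powr_mono2') auto
    then have "(t - s) * ((p - 1) * m powr (p - 2)) \<le> (t - s) * ((p - 1) * z powr (p - 2))"
      using p that by (intro mult_left_mono) auto
    then show ?thesis
      using z(3) by (simp add: mult_ac)
  qed
  consider "0 \<le> s" | "t \<le> 0" | "s < 0" "0 < t"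
    by linarith
  then show ?thesis
  proof cases
    case 1
    then show ?thesis using pos[of s t] st by (auto simp: sgn_if)
  next
    case 2
    then show ?thesis using pos[of "- t" "- s"] st by (auto simp: sgn_if uminus_powr_eq)
  next
    case 3
    then show ?thesis using zero[of "- s"] zero[of t] st by (auto simp: algebra_simps)
  qed
qed

text \<open>With \<^term>\<open>m = \<bar>a\<bar> + \<bar>b\<bar>\<close>, the function \<open>t \<mapsto> \<bar>t\<bar>\<^sup>p / p - (p - 1) m\<^sup>p\<^sup>-\<^sup>2 t\<^sup>2 / 2\<close> has a
  nondecreasing derivative on the interval \<open>[-m, m]\<close>.\<close>

lemma bregman_pointwise_lower:
  fixes p a b :: real
  assumes p: "1 < p" "p \<le> 2"
  shows "(p - 1) / 2 * (\<bar>a\<bar> + \<bar>b\<bar>) powr (p - 2) * (b - a)\<^sup>2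
    \<le> \<bar>b\<bar> powr p / p - \<bar>a\<bar> powr p / p - \<bar>a\<bar> powr (p - 1) * sgn a * (b - a)"
proof -
  define m where "m = \<bar>a\<bar> + \<bar>b\<bar>"
  define k where "k = (p - 1) * m powr (p - 2)"
  define h where "h t = \<bar>t\<bar> powr p / p - k / 2 * t\<^sup>2" for t
  define g where "g t = \<bar>t\<bar> powr (p - 1) * sgn t - k * t" for t
  have d: "(h has_real_derivative g t) (at t)" for t
    unfolding h_def g_def
    by (rule derivative_eq_intros has_real_derivative_abs_powr p refl)+ simp
  have gm: "g s \<le> g t" if "s \<le> t" "\<bar>s\<bar> \<le> m" "\<bar>t\<bar> \<le> m" for s t
    using signed_powr_mono[OF p that] by (simp add: g_def k_def algebra_simps)
  \<comment> \<open>The tangent inequality for \<open>h\<close> follows from the mean value theorem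
    and the monotonicity of \<open>g\<close>. When \<open>h\<close> and \<open>g\<close> are
    expanded, the quadratic parts combine to k/2 (b - a)^2, which is the asserted lower
    bound.\<close>
  have "h b - h a \<ge> g a * (b - a)"
  proof (cases a b rule: linorder_cases)
    case less
    then obtain z where z: "a < z" "z < b" "h b - h a = (b - a) * g z"
      using MVT2[of a b h g] d by auto
    then show ?thesis
      using gm[of a z] less by (auto simp: m_def mult.commute intro!: mult_left_mono)
  next
    case greater
    then obtain z where z: "b < z" "z < a" "h a - h b = (a - b) * g z"
      using MVT2[of b a h g] d by auto
    then have "(a - b) * g z \<le> (a - b) * g a"
      using gm[of z a] greater by (auto simp: m_def intro!: mult_left_mono)
    then show ?thesis
      using z(3) by (simp add: algebra_simps)
  qed auto
  then show ?thesis
    by (simp add: h_def g_def k_def m_def power2_eq_square algebra_simps) (simp add: field_simps)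
qed

text \<open>For equal signs this is subadditivity of the power p - 1 \<le> 1. For opposite signs
  both \<bar>a\<bar> and \<bar>b\<bar> are at most \<bar>a - b\<bar>, which costs the factor
  2.\<close>

lemma signed_powr_Hoelder:
  fixes p a b :: real
  assumes p: "1 < p" "p \<le> 2"
  shows "\<bar>\<bar>a\<bar> powr (p - 1) * sgn a - \<bar>b\<bar> powr (p - 1) * sgn b\<bar> \<le> 2 * \<bar>a - b\<bar> powr (p - 1)"
proof -
  have same: "\<bar>a powr (p - 1) - b powr (p - 1)\<bar> \<le> \<bar>a - b\<bar> powr (p - 1)" if "0 \<le> a" "0 \<le> b" for a b :: real
  proof (cases "a \<le> b")
    case True
    then show ?thesis
      using powr_subadditive[of "p - 1" a "b - a"] powr_mono2[of "p - 1" a b] p that by auto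
  next
    case False
    then show ?thesis
      using powr_subadditive[of "p - 1" b "a - b"] powr_mono2[of "p - 1" b a] p that by auto
  qed
  have opp: "a powr (p - 1) + b powr (p - 1) \<le> 2 * (a + b) powr (p - 1)" if "0 \<le> a" "0 \<le> b" for a b :: real
    using powr_mono2[of "p - 1" a "a + b"] powr_mono2[of "p - 1" b "a + b"] p that by simp
  have le2: "x \<le> 2 * y" if "x \<le> y" "0 \<le> y" for x y :: real
    using that by simp
  consider "0 \<le> a" "0 \<le> b" | "a \<le> 0" "b \<le> 0" | "a < 0" "0 < b" | "b < 0" "0 < a"
    by linarith
  then show ?thesis
  proof cases
    case 1
    then show ?thesis using le2[OF same[of a b]] by (auto simp: sgn_if)
  next
    case 2
    have "\<bar>(- a) powr (p - 1) - (- b) powr (p - 1)\<bar> \<le> \<bar>a - b\<bar> powr (p - 1)"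
      using same[of "- a" "- b"] 2 by (simp add: abs_minus_commute)
    then show ?thesis using le2 2 by (auto simp: sgn_if uminus_powr_eq abs_minus_commute)
  next
    case 3
    then show ?thesis using opp[of "- a" b] by (auto simp: sgn_if uminus_powr_eq abs_minus_commute add.commute)
  next
    case 4
    then show ?thesis using opp[of a "- b"] by (auto simp: sgn_if uminus_powr_eq)
  qed
qed

section \<open>The Bregman distance and the modulus of continuity of the duality map\<close>

context conjugate_exponents
begin

text \<open>The Bregman distance is the series of the scalar Bregman distances of the coordinates,
  so pointwise inequalities can be summed.\<close>

lemma bregman_sums:
  assumes x: "x \<in> lp p" and z: "z \<in> lp p"
  shows "(\<lambda>i. \<bar>z i\<bar> powr p / p - \<bar>x i\<bar> powr p / p - \<bar>x i\<bar> powr (p - 1) * sgn (x i) * (z i - x i))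
    sums bregman p z x"
proof -
  have "(\<lambda>i. \<bar>w i\<bar> powr p / p) sums fp p w" if "w \<in> lp p" for w
    using that p1 sums_divide[OF summable_sums, of "\<lambda>i. \<bar>w i\<bar> powr p" p]
    by (simp add: fp_def lpnorm_powr) (simp add: lp_def)
  moreover have "(\<lambda>i. duality_map p x i * (z - x) i) sums pairing (duality_map p x) (z - x)"
    unfolding pairing_def
    using pairing_Holder(1)[OF duality_map_lp(1)[OF x] lp_diff_Minkowski(1)[OF _ z x]] p1
    by (intro summable_sums) simp
  ultimately show ?thesis
    unfolding bregman_def using x z by (auto intro!: sums_diff simp: duality_map_def)
qed

lemma bregman_nonneg:
  assumes "x \<in> lp p" "z \<in> lp p"
  shows "0 \<le> bregman p z x"
proof -
  have "0 \<le> \<bar>z i\<bar> powr p / p - \<bar>x i\<bar> powr p / p - \<bar>x i\<bar> powr (p - 1) * sgn (x i) * (z i - x i)" for i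
    by (rule order_trans[OF _ bregman_pointwise_lower[OF p1 p2]]) (use p1 in auto)
  then show ?thesis
    using sums_le[OF _ sums_zero bregman_sums[OF assms]] by auto
qed

text \<open>The pointwise bound sums up through Hoelder's inequality for
  \<open>\<bar>z\<^sub>i - x\<^sub>i\<bar>\<^sup>p = ((\<bar>x\<^sub>i\<bar> + \<bar>z\<^sub>i\<bar>)\<^sup>p\<^sup>-\<^sup>2 \<bar>z\<^sub>i - x\<^sub>i\<bar>\<^sup>2)\<^sup>p\<^sup>/\<^sup>2 ((\<bar>x\<^sub>i\<bar> + \<bar>z\<^sub>i\<bar>)\<^sup>p)\<^sup>1\<^sup>-\<^sup>p\<^sup>/\<^sup>2\<close>.\<close>

lemma bregman_lower:
  assumes x: "x \<in> lp p" and z: "z \<in> lp p" and R: "lpnorm p x + lpnorm p z \<le> R" "0 < R"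
  shows "(p - 1) / 2 * R powr (p - 2) * (lpnorm p (z - x))\<^sup>2 \<le> bregman p z x"
proof -
  define u where "u i = (\<bar>x i\<bar> + \<bar>z i\<bar>) powr (p - 2) * (z i - x i)\<^sup>2" for i
  define v where "v i = (\<bar>x i\<bar> + \<bar>z i\<bar>) powr p" for i
  define w where "w i = \<bar>z i\<bar> powr p / p - \<bar>x i\<bar> powr p / p - \<bar>x i\<bar> powr (p - 1) * sgn (x i) * (z i - x i)" for i
  have w: "w sums bregman p z x"
    unfolding w_def using bregman_sums[OF x z] .
  have uw: "(p - 1) / 2 * u i \<le> w i" for i
    using bregman_pointwise_lower[OF p1 p2, of "x i" "z i"] by (simp add: u_def w_def mult.assoc)
  have u0: "u i \<ge> 0" for i
    by (simp add: u_def)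
  have su: "summable u"
  proof (rule summable_comparison_test_ev)
    show "summable (\<lambda>i. 2 / (p - 1) * w i)"
      using w by (intro summable_mult) (auto simp: sums_iff)
    show "\<forall>\<^sub>F i in sequentially. norm (u i) \<le> 2 / (p - 1) * w i"
      using uw u0 p1 by (auto simp: field_simps)
  qed
  have uD: "(p - 1) / 2 * (\<Sum>i. u i) \<le> bregman p z x"
    using sums_le[OF uw sums_mult[OF summable_sums[OF su]] w] by simp
  have ax: "(\<lambda>i. \<bar>x i\<bar>) \<in> lp p" "(\<lambda>i. \<bar>z i\<bar>) \<in> lp p"
    using x z by (auto simp: lp_def)
  have nx: "lpnorm p (\<lambda>i. \<bar>x i\<bar>) = lpnorm p x" "lpnorm p (\<lambda>i. \<bar>z i\<bar>) = lpnorm p z"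
    by (auto simp: lpnorm_def)
  define y where "y = (\<lambda>i. \<bar>x i\<bar>) + (\<lambda>i. \<bar>z i\<bar>)"
  have y: "y \<in> lp p" "lpnorm p y \<le> R"
    using lp_add_Minkowski[OF less_imp_le[OF p1] ax] R unfolding y_def nx by auto
  have vy: "v = (\<lambda>i. \<bar>y i\<bar> powr p)"
    by (simp add: v_def y_def fun_eq_iff)
  then have sv: "summable v"
    using y(1) by (simp add: lp_def)
  have vR: "(\<Sum>i. v i) \<le> R powr p"
    using powr_mono2[OF _ _ y(2), of p] y(1) p1 lpnorm_powr[of p y] by (simp add: vy)
  have v0: "v i \<ge> 0" for i
    by (simp add: v_def)
  have eq: "u i powr (p / 2) * v i powr (1 - p / 2) = \<bar>(z - x) i\<bar> powr p" for i
  proof (cases "x i = 0 \<and> z i = 0")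
    case False
    then have m: "\<bar>x i\<bar> + \<bar>z i\<bar> > 0" by linarith
    have "((z i - x i)\<^sup>2) powr (p / 2) = \<bar>z i - x i\<bar> powr p"
      using powr_powr[of "\<bar>z i - x i\<bar>" 2 "p / 2"] by simp
    moreover have "(p - 2) * (p / 2) + p * (1 - p / 2) = 0"
      by (simp add: field_simps)
    then have "((\<bar>x i\<bar> + \<bar>z i\<bar>) powr (p - 2)) powr (p / 2) * ((\<bar>x i\<bar> + \<bar>z i\<bar>) powr p) powr (1 - p / 2) = 1"
      unfolding powr_powr powr_add[symmetric] using m by simp
    ultimately show ?thesis
      by (simp add: u_def v_def powr_mult)
  qed (auto simp: u_def v_def)
  have "lpnorm p (z - x) powr p = (\<Sum>i. \<bar>(z - x) i\<bar> powr p)"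
    using p1 lp_diff_Minkowski(1)[OF _ z x] by (intro lpnorm_powr) auto
  also have "\<dots> \<le> (\<Sum>i. u i) powr (p / 2) * (\<Sum>i. v i) powr (1 - p / 2)"
    using weighted_Holder(2)[of "p / 2" u v, OF _ _ u0 su v0 sv] p1 p2 unfolding eq by simp
  also have "\<dots> \<le> (\<Sum>i. u i) powr (p / 2) * (R powr p) powr (1 - p / 2)"
    using p2 vR suminf_nonneg[OF sv v0] by (intro mult_left_mono powr_mono2) auto
  \<comment> \<open>Raising Hoelder's bound to the power 2/p isolates the squared norm: it is at
    most (\<Sum>i. u i) R^(2 - p), and the factor R^(p - 2) of the claim cancels the last
    power.\<close>
  finally have "(lpnorm p (z - x) powr p) powr (2 / p)
      \<le> ((\<Sum>i. u i) powr (p / 2) * (R powr p) powr (1 - p / 2)) powr (2 / p)"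
    using p1 by (intro powr_mono2) auto
  also have "\<dots> = (\<Sum>i. u i) * R powr (2 - p)"
  proof -
    have "p * (1 - p / 2) * (2 / p) = 2 - p"
      using p1 by (simp add: field_simps)
    then have "((R powr p) powr (1 - p / 2)) powr (2 / p) = R powr (2 - p)"
      by (simp only: powr_powr)
    moreover have "((\<Sum>i. u i) powr (p / 2)) powr (2 / p) = (\<Sum>i. u i)"
      using p1 suminf_nonneg[OF su u0] by (simp add: powr_powr)
    ultimately show ?thesis
      by (simp add: powr_mult)
  qed
  also have "(lpnorm p (z - x) powr p) powr (2 / p) = (lpnorm p (z - x))\<^sup>2"
    using p1 by (simp add: powr_powr)
  finally have "(p - 1) / 2 * R powr (p - 2) * (lpnorm p (z - x))\<^sup>2
      \<le> (p - 1) / 2 * R powr (p - 2) * ((\<Sum>i. u i) * R powr (2 - p))"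
    using p1 by (intro mult_left_mono) auto
  also have "\<dots> = (p - 1) / 2 * (\<Sum>i. u i)"
    using R(2) powr_add[of R "p - 2" "2 - p"] by simp
  finally show ?thesis
    using uD by simp
qed

text \<open>The values of \<open>fp\<close> cancel and only the linear terms survive. For a dual
  step the difference of the duality maps is a multiple of the gradient, so the identity relates the
  change of the distance to \<open>u\<close> to the gradient.\<close>

lemma three_point_identity:
  assumes "x \<in> lp p" "w \<in> lp p" "u \<in> lp p"
  shows "bregman p u x - bregman p u w - bregman p w x
    = pairing (\<lambda>i. duality_map p x i - duality_map p w i) (w - u)"
proof -
  note J = duality_map_lp(1)[OF assms(1)] duality_map_lp(1)[OF assms(2)]
  show ?thesis
    using assms J lp_diff_Minkowski(1)[OF less_imp_le[OF p1]] pairing_lincomb_left[OF J, of "w - u" "-1"]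
    by (simp add: bregman_def pairing_diff_right)
qed

lemma bregman_self: "x \<in> lp p \<Longrightarrow> bregman p x x = 0"
  by (simp add: bregman_def pairing_def)

text \<open>The scalar estimate is raised to the power q and summed, with q (p - 1) = p. It serves
  to show that a long step in the dual space is also long in the primal space.\<close>

lemma duality_map_Hoelder:
  assumes x: "x \<in> lp p" and z: "z \<in> lp p"
  shows "lpnorm q (\<lambda>i. duality_map p x i - duality_map p z i) \<le> 2 * lpnorm p (x - z) powr (p - 1)"
proof (rule lpnorm_le)
  note xz = lp_diff_Minkowski(1)[OF less_imp_le[OF p1] x z]
  show 1: "(\<lambda>i. duality_map p x i - duality_map p z i) \<in> lp q"
    using lp_diff_Minkowski(1)[OF _ duality_map_lp(1)[OF x] duality_map_lp(1)[OF z]] q_ge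
    by (simp add: fun_diff_def)
  have le: "\<bar>duality_map p x i - duality_map p z i\<bar> powr q \<le> 2 powr q * \<bar>(x - z) i\<bar> powr p" for i
  proof -
    have "\<bar>duality_map p x i - duality_map p z i\<bar> powr q \<le> (2 * \<bar>x i - z i\<bar> powr (p - 1)) powr q"
      using signed_powr_Hoelder[OF p1 p2] q_ge by (intro powr_mono2) (auto simp: duality_map_def)
    also have "\<dots> = 2 powr q * \<bar>x i - z i\<bar> powr p"
      using pq by (simp add: powr_mult powr_powr mult.commute)
    finally show ?thesis by simp
  qed
  have "(\<Sum>i. \<bar>duality_map p x i - duality_map p z i\<bar> powr q) \<le> (\<Sum>i. 2 powr q * \<bar>(x - z) i\<bar> powr p)"
    using le 1 xz by (intro suminf_le summable_mult) (auto simp: lp_def)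
  also have "\<dots> = 2 powr q * lpnorm p (x - z) powr p"
    using xz p1 lpnorm_powr[OF _ xz] by (subst suminf_mult) (auto simp: lp_def)
  also have "\<dots> = (2 * lpnorm p (x - z) powr (p - 1)) powr q"
    using pq by (simp add: powr_mult powr_powr mult.commute)
  finally show "(\<Sum>i. \<bar>duality_map p x i - duality_map p z i\<bar> powr q) \<le> (2 * lpnorm p (x - z) powr (p - 1)) powr q" .
qed (use q_ge in auto)

end

section \<open>Operators and adjoints\<close>

lemma lp_unit: "(\<lambda>j. if j = i then 1 else 0) \<in> lp p"
  unfolding lp_def mem_Collect_eq by (rule summable_finite[of "{i}"]) auto

text \<open>The defining set is bounded by \<bar>C\<bar>, the sign of C being unknown, so the
  supremum is a genuine upper bound; then \<open>h\<close> is scaled to norm 1. For norm 0 the bound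
  with C already forces T h = 0.\<close>

lemma lp_opnorm:
  assumes p: "1 \<le> p" and T: "lp_bounded_linear p T" and h: "h \<in> lp p"
  shows "norm (T h) \<le> lp_opnorm p T * lpnorm p h"
proof (cases "lpnorm p h = 0")
  case True
  then show ?thesis
    using T h by (auto simp: lp_bounded_linear_def)
next
  case False
  obtain C where C: "\<And>x. x \<in> lp p \<Longrightarrow> norm (T x) \<le> C * lpnorm p x"
    using T unfolding lp_bounded_linear_def by blast
  define N where "N = lpnorm p h"
  have N: "N > 0"
    using False lpnorm_nonneg[of p h] unfolding N_def by linarith
  define e where "e = (\<lambda>i. inverse N * h i)"
  have e: "e \<in> lp p" "lpnorm p e = 1"
    using N h p by (auto simp: e_def lpnorm_scale N_def)
  have "norm (T e) \<le> lp_opnorm p T"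
    unfolding lp_opnorm_def
  proof (rule cSup_upper)
    show "norm (T e) \<in> {norm (T h) |h. h \<in> lp p \<and> lpnorm p h \<le> 1}"
      using e by auto
    have "norm (T x) \<le> \<bar>C\<bar>" if "x \<in> lp p" "lpnorm p x \<le> 1" for x
    proof -
      have "C * lpnorm p x \<le> \<bar>C\<bar> * 1"
        using that by (intro mult_mono) auto
      then show ?thesis using C[OF that(1)] by linarith
    qed
    then show "bdd_above {norm (T h) |h. h \<in> lp p \<and> lpnorm p h \<le> 1}"
      by (intro bdd_aboveI[of _ "\<bar>C\<bar>"]) auto
  qed
  moreover have "T e = inverse N *\<^sub>R T h"
    using T h unfolding e_def lp_bounded_linear_def by blast
  ultimately show ?thesis
    using N by (simp add: N_def[symmetric] field_simps)
qed

lemma lp_opnorm_nonneg: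
  assumes "1 \<le> p" and T: "lp_bounded_linear p T"
  shows "0 \<le> lp_opnorm p T"
proof -
  have e: "(\<lambda>i::nat. if i = 0 then 1 else 0 :: real) \<in> lp p"
    by (rule lp_unit)
  then have "lpnorm p (\<lambda>i::nat. if i = 0 then 1 else 0) \<noteq> 0"
    using assms by (subst lpnorm_eq_0_iff) (auto simp: fun_eq_iff)
  then have "0 < lpnorm p (\<lambda>i::nat. if i = 0 then 1 else 0)"
    using lpnorm_nonneg by (metis order_le_less)
  moreover have "0 \<le> lp_opnorm p T * lpnorm p (\<lambda>i::nat. if i = 0 then 1 else 0)"
    by (rule order_trans[OF norm_ge_zero lp_opnorm[OF assms e]])
  ultimately show ?thesis
    by (simp add: zero_le_mult_iff)
qed

lemma lp_bounded_linear_diff: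
  assumes "lp_bounded_linear p T" "lp_bounded_linear p S"
  shows "lp_bounded_linear p (\<lambda>h. T h - S h)"
proof -
  obtain C where C: "\<And>x. x \<in> lp p \<Longrightarrow> norm (T x) \<le> C * lpnorm p x"
    using assms(1) unfolding lp_bounded_linear_def by blast
  obtain D where D: "\<And>x. x \<in> lp p \<Longrightarrow> norm (S x) \<le> D * lpnorm p x"
    using assms(2) unfolding lp_bounded_linear_def by blast
  have "norm (T x - S x) \<le> (C + D) * lpnorm p x" if "x \<in> lp p" for x
    using C[OF that] D[OF that] norm_triangle_ineq4[of "T x" "S x"] by (simp add: algebra_simps)
  then have "\<exists>B. \<forall>x\<in>lp p. norm (T x - S x) \<le> B * lpnorm p x"
    by blast
  then show ?thesis
    using assms unfolding lp_bounded_linear_def by (auto simp: scaleR_right_diff_distrib)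
qed

section \<open>Truncated sequences and the representation of functionals\<close>

definition truncate :: "nat \<Rightarrow> (nat \<Rightarrow> real) \<Rightarrow> nat \<Rightarrow> real" where
  "truncate n x = (\<lambda>i. if i < n then x i else 0)"

lemma truncate_lp: "truncate n x \<in> lp p"
  unfolding lp_def mem_Collect_eq by (rule summable_finite[of "{..<n}"]) (auto simp: truncate_def)

lemma lpnorm_truncate_powr:
  assumes "p > 0"
  shows "lpnorm p (truncate n x) powr p = (\<Sum>i<n. \<bar>x i\<bar> powr p)"
proof -
  have "(\<Sum>i. \<bar>truncate n x i\<bar> powr p) = (\<Sum>i<n. \<bar>truncate n x i\<bar> powr p)"
    by (rule suminf_finite[of "{..<n}"]) (auto simp: truncate_def)
  also have "\<dots> = (\<Sum>i<n. \<bar>x i\<bar> powr p)"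
    by (rule sum.cong) (auto simp: truncate_def)
  finally show ?thesis
    using assms by (simp add: lpnorm_powr truncate_lp)
qed

text \<open>The p-th power of the norm of a tail is the tail of a convergent series.\<close>

lemma truncate_tendsto:
  assumes p: "1 \<le> p" and x: "x \<in> lp p"
  shows "(\<lambda>n. lpnorm p (x - truncate n x)) \<longlonglongrightarrow> 0"
proof -
  have s: "summable (\<lambda>i. \<bar>x i\<bar> powr p)"
    using x by (simp add: lp_def)
  have eq: "lpnorm p (x - truncate n x) = ((\<Sum>i. \<bar>x i\<bar> powr p) - (\<Sum>i<n. \<bar>x i\<bar> powr p)) powr (1 / p)" for n
  proof -
    have "(\<lambda>i. if i \<in> {..<n} then \<bar>x i\<bar> powr p else 0) sums (\<Sum>i\<in>{..<n}. \<bar>x i\<bar> powr p)"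
      by (rule sums_If_finite_set) simp
    then have "(\<lambda>i. \<bar>x i\<bar> powr p - (if i \<in> {..<n} then \<bar>x i\<bar> powr p else 0)) sums
        ((\<Sum>i. \<bar>x i\<bar> powr p) - (\<Sum>i<n. \<bar>x i\<bar> powr p))"
      using s by (intro sums_diff summable_sums)
    moreover have "(\<lambda>i. \<bar>x i\<bar> powr p - (if i \<in> {..<n} then \<bar>x i\<bar> powr p else 0)) = (\<lambda>i. \<bar>(x - truncate n x) i\<bar> powr p)"
      by (auto simp: truncate_def fun_eq_iff)
    ultimately show ?thesis
      by (simp add: lpnorm_def sums_iff)
  qed
  have "(\<lambda>n. (\<Sum>i. \<bar>x i\<bar> powr p) - (\<Sum>i<n. \<bar>x i\<bar> powr p)) \<longlonglongrightarrow> (\<Sum>i. \<bar>x i\<bar> powr p) - (\<Sum>i. \<bar>x i\<bar> powr p)"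
    by (intro tendsto_intros summable_LIMSEQ s)
  then have "(\<lambda>n. ((\<Sum>i. \<bar>x i\<bar> powr p) - (\<Sum>i<n. \<bar>x i\<bar> powr p)) powr (1 / p)) \<longlonglongrightarrow> 0"
    using p s sum_le_suminf[OF s] by (intro tendsto_zero_powrI[where b = "1 / p"] always_eventually) auto
  then show ?thesis
    by (simp add: eq)
qed

context conjugate_exponents
begin

text \<open>The coordinates of \<xi> are the values of the functional on the unit vectors. Testing
  on truncations bounds the partial sums of \<bar>\<xi> i\<bar>^q; density of the finitely supported
  sequences then extends the representation to all of the space.\<close>

lemma Riesz_representation:
  fixes T :: "(nat \<Rightarrow> real) \<Rightarrow> 'y::real_inner"
  assumes T: "lp_bounded_linear p T"
  shows "\<exists>\<xi>\<in>lp q. lpnorm q \<xi> \<le> norm w * lp_opnorm p T \<and> (\<forall>h\<in>lp p. pairing \<xi> h = w \<bullet> T h)"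
proof -
  define \<xi> where "\<xi> i = w \<bullet> T (\<lambda>j. if j = i then 1 else 0)" for i
  define B where "B = norm w * lp_opnorm p T"
  have pp: "1 \<le> p" using p1 by simp
  have B0: "B \<ge> 0"
    unfolding B_def using lp_opnorm_nonneg[OF pp T] by simp
  have e: "(\<lambda>j::nat. if j = i then 1 else 0 :: real) \<in> lp p" for i
    by (rule lp_unit)
  have bound: "\<bar>w \<bullet> T h\<bar> \<le> B * lpnorm p h" if "h \<in> lp p" for h
    using Cauchy_Schwarz_ineq2[of w "T h"] mult_left_mono[OF lp_opnorm[OF pp T that], of "norm w"]
    by (simp add: B_def)
  have add: "T (x + z) = T x + T z" if "x \<in> lp p" "z \<in> lp p" for x z
    using T that by (simp add: lp_bounded_linear_def)
  have scale: "T (\<lambda>i. a * x i) = a *\<^sub>R T x" if "x \<in> lp p" for a x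
    using T that by (simp add: lp_bounded_linear_def)
  have trunc: "w \<bullet> T (truncate n h) = (\<Sum>i<n. \<xi> i * h i)" for n h
  proof (induction n)
    case 0
    have "T (truncate 0 h) = 0"
      using scale[OF truncate_lp, of 0 0 h] by (simp add: truncate_def)
    then show ?case by simp
  next
    case (Suc n)
    have "truncate (Suc n) h = truncate n h + (\<lambda>i. h n * (if i = n then 1 else 0))"
      by (auto simp: truncate_def fun_eq_iff less_Suc_eq)
    then have "T (truncate (Suc n) h) = T (truncate n h) + h n *\<^sub>R T (\<lambda>j. if j = n then 1 else 0)"
      by (simp only: add[OF truncate_lp lp_scale[OF e]] scale[OF e])
    then show ?case
      using Suc by (simp add: \<xi>_def inner_add_right mult.commute)
  qed
  have S: "(\<Sum>i<n. \<bar>\<xi> i\<bar> powr q) \<le> B powr q" for n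
  proof -
    \<comment> \<open>This is the extremal test vector: on its truncation the functional takes the
      value S, while the norm is S^(1/p). Hence S \<le> B S^(1/p), and dividing gives S^(1/q) \<le>
      B.\<close>
    define h where "h = duality_map q \<xi>"
    define S where "S = (\<Sum>i<n. \<bar>\<xi> i\<bar> powr q)"
    have S0: "S \<ge> 0" by (auto simp: S_def intro: sum_nonneg)
    have "\<xi> i * h i = \<bar>\<xi> i\<bar> powr q" for i
    proof (cases "\<xi> i = 0")
      case False
      then have "\<xi> i * h i = \<bar>\<xi> i\<bar> * \<bar>\<xi> i\<bar> powr (q - 1)"
        by (simp add: h_def duality_map_def sgn_if)
      then show ?thesis
        using powr_mult_base[of "\<bar>\<xi> i\<bar>" "q - 1"] by simp
    qed (simp add: h_def duality_map_def)
    then have "w \<bullet> T (truncate n h) = S"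
      by (simp add: S_def trunc)
    moreover have "lpnorm p (truncate n h) powr p = S"
      using p1 by (simp add: lpnorm_truncate_powr S_def h_def duality_map_abs powr_powr)
        (simp add: pq mult.commute[of "q - 1"])
    then have "lpnorm p (truncate n h) = S powr (1 / p)"
      using p1 by (auto simp: powr_powr)
    ultimately have le: "S \<le> B * S powr (1 / p)"
      using bound[OF truncate_lp, of n h] by simp
    show ?thesis
    proof (cases "S = 0")
      case False
      then have pos: "S > 0" using S0 by simp
      have "S = S powr (1 / q) * S powr (1 / p)"
        using pos powr_add[of S "1 / q" "1 / p"] conj by (simp add: add.commute)
      then have "S powr (1 / q) * S powr (1 / p) \<le> B * S powr (1 / p)"
        using le by (rule ord_eq_le_trans[OF sym])
      then have "S powr (1 / q) \<le> B"
        using pos by (simp add: mult_le_cancel_right)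
      then have "(S powr (1 / q)) powr q \<le> B powr q"
        using q_ge by (intro powr_mono2) auto
      then show ?thesis
        using q_ge pos by (simp add: powr_powr S_def)
    next
      case True
      have "(\<Sum>i<n. \<bar>\<xi> i\<bar> powr q) = 0"
        using True unfolding S_def .
      then show ?thesis
        by (simp only: powr_ge_zero)
    qed
  qed
  have \<xi>: "\<xi> \<in> lp q"
    unfolding lp_def mem_Collect_eq by (rule summableI_nonneg_bounded[OF _ S]) simp
  then have "(\<Sum>i. \<bar>\<xi> i\<bar> powr q) \<le> B powr q"
    using S by (intro suminf_le_const) (auto simp: lp_def)
  then have n: "lpnorm q \<xi> \<le> B"
    using \<xi> B0 q_ge by (intro lpnorm_le) auto
  have "pairing \<xi> h = w \<bullet> T h" if h: "h \<in> lp p" for h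
  proof (rule LIMSEQ_unique)
    show "(\<lambda>n. w \<bullet> T (truncate n h)) \<longlonglongrightarrow> pairing \<xi> h"
      unfolding trunc pairing_def by (intro summable_LIMSEQ pairing_Holder(1)[OF \<xi> h])
    have "(\<lambda>n. w \<bullet> T h - w \<bullet> T (truncate n h)) \<longlonglongrightarrow> 0"
    proof (rule Lim_null_comparison)
      have "w \<bullet> T h - w \<bullet> T (truncate n h) = w \<bullet> T (h - truncate n h)" for n
        using add[OF truncate_lp lp_diff_Minkowski(1)[OF pp h truncate_lp], of n h n h]
        by (simp add: inner_add_right)
      then show "\<forall>\<^sub>F n in sequentially. norm (w \<bullet> T h - w \<bullet> T (truncate n h)) \<le> B * lpnorm p (h - truncate n h)"
        using bound[OF lp_diff_Minkowski(1)[OF pp h truncate_lp]] by auto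
      show "(\<lambda>n. B * lpnorm p (h - truncate n h)) \<longlonglongrightarrow> 0"
        by (intro tendsto_mult_right_zero truncate_tendsto pp h)
    qed
    from tendsto_diff[OF tendsto_const[of "w \<bullet> T h"] this]
    show "(\<lambda>n. w \<bullet> T (truncate n h)) \<longlonglongrightarrow> w \<bullet> T h"
      by simp
  qed
  then show ?thesis
    using \<xi> n by (auto simp: B_def)
qed

lemma lp_adjoint:
  fixes T :: "(nat \<Rightarrow> real) \<Rightarrow> 'y::real_inner"
  assumes T: "lp_bounded_linear p T"
  shows lp_adjoint_lq: "lp_adjoint p q T w \<in> lp q"
    and lpnorm_lp_adjoint: "lpnorm q (lp_adjoint p q T w) \<le> norm w * lp_opnorm p T"
    and pairing_lp_adjoint: "\<And>h. h \<in> lp p \<Longrightarrow> pairing (lp_adjoint p q T w) h = w \<bullet> T h"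
proof -
  obtain \<xi> where \<xi>: "\<xi> \<in> lp q" "lpnorm q \<xi> \<le> norm w * lp_opnorm p T" "\<forall>h\<in>lp p. pairing \<xi> h = w \<bullet> T h"
    using Riesz_representation[OF T] by blast
  \<comment> \<open>Unit vectors recover every coordinate, so the definite description in
    \<open>lp_adjoint\<close> has a unique referent.\<close>
  have "\<eta> = \<xi>" if "\<forall>h\<in>lp p. pairing \<eta> h = w \<bullet> T h" for \<eta>
  proof
    fix i
    define e where "e = (\<lambda>j::nat. if j = i then 1 else 0 :: real)"
    have "e \<in> lp p"
      unfolding e_def by (rule lp_unit)
    then have "pairing \<eta> e = pairing \<xi> e"
      using that \<xi> by simp
    moreover have "pairing \<zeta> e = \<zeta> i" for \<zeta>
      using suminf_finite[of "{i}" "\<lambda>j. \<zeta> j * e j"] by (simp add: pairing_def e_def)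
    ultimately show "\<eta> i = \<xi> i" by simp
  qed
  then have "lp_adjoint p q T w = \<xi>"
    unfolding lp_adjoint_def using \<xi> by (intro the_equality) blast+
  then show "lp_adjoint p q T w \<in> lp q"
    and "lpnorm q (lp_adjoint p q T w) \<le> norm w * lp_opnorm p T"
    and "\<And>h. h \<in> lp p \<Longrightarrow> pairing (lp_adjoint p q T w) h = w \<bullet> T h"
    using \<xi> by auto
qed

end

section \<open>The Tikhonov functional\<close>

locale tikhonov_functional = conjugate_exponents p q for p q :: real +
  fixes F :: "(nat \<Rightarrow> real) \<Rightarrow> 'y::real_inner" and F' :: "(nat \<Rightarrow> real) \<Rightarrow> (nat \<Rightarrow> real) \<Rightarrow> 'y"
    and yd :: 'y and L c ct \<alpha> :: real
  assumes frechet: "\<And>x. x \<in> lp p \<Longrightarrow> lp_frechet p F (F' x) x"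
    and L_pos: "L > 0"
    and L: "\<And>x z. x \<in> lp p \<Longrightarrow> z \<in> lp p \<Longrightarrow> lp_opnorm p (\<lambda>h. F' x h - F' z h) \<le> L * lpnorm p (x - z)"
    and c_pos: "c > 0"
    and c: "\<And>x z. x \<in> lp p \<Longrightarrow> z \<in> lp p \<Longrightarrow> norm (F x - F z - F' z (x - z)) \<le> c * bregman p x z"
    and ct_pos: "ct > 0"
    and ct: "\<And>x z. x \<in> lp p \<Longrightarrow> z \<in> lp p \<Longrightarrow> bregman p z x \<le> ct * lpnorm p (x - z) powr p"
    and \<alpha>_pos: "\<alpha> > 0"
begin

abbreviation \<Phi> where "\<Phi> \<equiv> tikhonov p F yd \<alpha>"

abbreviation grad where "grad \<equiv> tikhonov_grad p q F F' yd \<alpha>"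

abbreviation N where "N x \<equiv> lp_opnorm p (F' x)"

lemma one_le_p: "1 \<le> p"
  using p1 by simp

lemmas lp_add = lp_add_Minkowski(1)[OF one_le_p]
lemmas lp_diff = lp_diff_Minkowski(1)[OF one_le_p]

lemma F'_linear: "x \<in> lp p \<Longrightarrow> lp_bounded_linear p (F' x)"
  using frechet by (auto simp: lp_frechet_def)

lemma F'_bound: "x \<in> lp p \<Longrightarrow> h \<in> lp p \<Longrightarrow> norm (F' x h) \<le> N x * lpnorm p h"
  by (intro lp_opnorm one_le_p F'_linear)

lemma N_nonneg: "x \<in> lp p \<Longrightarrow> 0 \<le> N x"
  by (intro lp_opnorm_nonneg one_le_p F'_linear)

text \<open>The Lipschitz condition on the derivative is evaluated on the unit ball. With z = 0 it
  bounds the derivative on bounded sets.\<close>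

lemma N_le:
  assumes x: "x \<in> lp p" and z: "z \<in> lp p"
  shows "N x \<le> N z + L * lpnorm p (x - z)"
  unfolding lp_opnorm_def[of p "F' x"]
proof (rule cSup_least)
  show "{norm (F' x h) |h. h \<in> lp p \<and> lpnorm p h \<le> 1} \<noteq> {}"
    using lpnorm_zero[of p] by (auto intro!: exI[of _ 0] simp del: lpnorm_zero)
next
  fix a assume "a \<in> {norm (F' x h) |h. h \<in> lp p \<and> lpnorm p h \<le> 1}"
  then obtain h where h: "a = norm (F' x h)" "h \<in> lp p" "lpnorm p h \<le> 1"
    by blast
  have "norm (F' x h - F' z h) \<le> lp_opnorm p (\<lambda>h. F' x h - F' z h) * lpnorm p h"
    by (intro lp_opnorm[of p "\<lambda>h. F' x h - F' z h"] one_le_p lp_bounded_linear_diff F'_linear x z h)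
  also have "\<dots> \<le> (L * lpnorm p (x - z)) * lpnorm p h"
    by (intro mult_right_mono L x z) auto
  finally have "norm (F' x h) \<le> (N z + L * lpnorm p (x - z)) * lpnorm p h"
    using F'_bound[OF z h(2)] norm_triangle_sub[of "F' x h" "F' z h"] by (simp add: algebra_simps)
  also have "\<dots> \<le> (N z + L * lpnorm p (x - z)) * 1"
    using h N_nonneg[OF z] L_pos by (intro mult_left_mono) auto
  finally show "a \<le> N z + L * lpnorm p (x - z)"
    by (simp add: h)
qed

text \<open>Pairing with a fixed \<open>w\<close> and restricting to a line turns \<open>F\<close>
  into a real function, for which the real mean value theorem is available.\<close>

lemma directional_derivative:
  assumes x: "x \<in> lp p" and h: "h \<in> lp p"
  shows "((\<lambda>t. w \<bullet> F (x + (\<lambda>i. t * h i))) has_real_derivative w \<bullet> F' (x + (\<lambda>i. t * h i)) h) (at t)"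
proof -
  define y where "y = x + (\<lambda>i. t * h i)"
  have y: "y \<in> lp p"
    unfolding y_def using x h by (intro lp_add lp_scale)
  have shift: "x + (\<lambda>i. (t + s) * h i) = y + (\<lambda>i. s * h i)" for s
    by (auto simp: y_def fun_eq_iff algebra_simps)
  have lin: "F' y (\<lambda>i. s * h i) = s *\<^sub>R F' y h" for s
    using F'_linear[OF y] h unfolding lp_bounded_linear_def by blast
  have "((\<lambda>s. (w \<bullet> F (y + (\<lambda>i. s * h i)) - w \<bullet> F y) / s) \<longlongrightarrow> w \<bullet> F' y h) (at 0)"
    unfolding LIM_def
  proof (intro allI impI)
    fix e :: real assume e: "e > 0"
    \<comment> \<open>The summand 1 keeps B positive when w or h vanishes, and makes the final
      estimate strict through (B - 1) / B < 1.\<close>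
    define B where "B = norm w * lpnorm p h + 1"
    have B: "B > 0" by (auto simp: B_def intro: add_nonneg_pos)
    have "e / B > 0" using e B by simp
    then obtain \<eta> where \<eta>: "\<eta> > 0" "\<And>k. k \<in> lp p \<Longrightarrow> lpnorm p k \<le> \<eta> \<Longrightarrow>
        norm (F (y + k) - F y - F' y k) \<le> e / B * lpnorm p k"
      using frechet[OF y] unfolding lp_frechet_def by blast
    have H: "lpnorm p h + 1 > 0" by (auto intro: add_nonneg_pos)
    show "\<exists>d>0. \<forall>s. s \<noteq> 0 \<and> dist s 0 < d \<longrightarrow>
        dist ((w \<bullet> F (y + (\<lambda>i. s * h i)) - w \<bullet> F y) / s) (w \<bullet> F' y h) < e"
    proof (intro exI conjI allI impI)
      show "\<eta> / (lpnorm p h + 1) > 0" using \<eta> H by simp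
      fix s :: real assume s: "s \<noteq> 0 \<and> dist s 0 < \<eta> / (lpnorm p h + 1)"
      define k where "k = (\<lambda>i. s * h i)"
      have k: "k \<in> lp p" "lpnorm p k = \<bar>s\<bar> * lpnorm p h"
        using h p1 by (auto simp: k_def lpnorm_scale)
      have "\<bar>s\<bar> * lpnorm p h \<le> \<bar>s\<bar> * (lpnorm p h + 1)"
        by (intro mult_left_mono) auto
      also have "\<dots> \<le> \<eta>"
        using s H by (simp add: field_simps)
      finally have "norm (F (y + k) - F y - F' y k) \<le> e / B * (\<bar>s\<bar> * lpnorm p h)"
        using \<eta>(2)[OF k(1)] k(2) by simp
      then have "norm w * norm (F (y + k) - F y - F' y k) \<le> norm w * (e / B * (\<bar>s\<bar> * lpnorm p h))"
        by (intro mult_left_mono) auto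
      then have "\<bar>w \<bullet> (F (y + k) - F y - F' y k)\<bar> \<le> norm w * (e / B * (\<bar>s\<bar> * lpnorm p h))"
        using Cauchy_Schwarz_ineq2[of w "F (y + k) - F y - F' y k"] by linarith
      also have "\<dots> = \<bar>s\<bar> * (e * ((B - 1) / B))"
        by (simp add: B_def)
      also have "\<dots> < \<bar>s\<bar> * (e * 1)"
        using s e B by (intro mult_strict_left_mono) auto
      finally have "\<bar>w \<bullet> (F (y + k) - F y - F' y k)\<bar> / \<bar>s\<bar> < e"
        using s by (simp add: field_simps)
      moreover have "(w \<bullet> F (y + k) - w \<bullet> F y) / s - w \<bullet> F' y h = w \<bullet> (F (y + k) - F y - F' y k) / s"
        using s lin[of s] by (simp add: k_def inner_diff_right diff_divide_distrib)
      ultimately show "dist ((w \<bullet> F (y + (\<lambda>i. s * h i)) - w \<bullet> F y) / s) (w \<bullet> F' y h) < e"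
        by (simp add: dist_real_def abs_divide k_def)
    qed
  qed
  then show ?thesis
    unfolding DERIV_def shift by (simp add: y_def)
qed

text \<open>The mean value theorem is applied to the pairing of \<open>F\<close> with w = F z - F x
  itself. Cauchy-Schwarz and cancellation of one factor \<open>norm w\<close> leave the derivative
  at an intermediate point, which \<open>N_le\<close> compares with the one at x.\<close>

lemma F_Lipschitz:
  assumes x: "x \<in> lp p" and z: "z \<in> lp p"
  shows "norm (F z - F x) \<le> (N x + L * lpnorm p (z - x)) * lpnorm p (z - x)"
proof (cases "F z = F x")
  case True
  then show ?thesis
    using N_nonneg[OF x] L_pos by simp
next
  case False
  define w h where "w = F z - F x" and "h = z - x"
  have h: "h \<in> lp p"
    unfolding h_def by (intro lp_diff z x)
  have "\<exists>t>0. t < 1 \<and> w \<bullet> F (x + (\<lambda>i. 1 * h i)) - w \<bullet> F (x + (\<lambda>i. 0 * h i))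
      = (1 - 0) * (w \<bullet> F' (x + (\<lambda>i. t * h i)) h)"
    by (intro MVT2 directional_derivative x h) auto
  moreover have "x + (\<lambda>i. 1 * h i) = z" "x + (\<lambda>i. 0 * h i) = x"
    by (auto simp: h_def)
  ultimately obtain t where t: "0 < t" "t < 1" "w \<bullet> F z - w \<bullet> F x = w \<bullet> F' (x + (\<lambda>i. t * h i)) h"
    by auto
  define y where "y = x + (\<lambda>i. t * h i)"
  have y: "y \<in> lp p"
    unfolding y_def using x h by (intro lp_add lp_scale)
  have "y - x = (\<lambda>i. t * h i)"
    by (auto simp: y_def)
  then have "lpnorm p (y - x) = t * lpnorm p h"
    using t h p1 by (simp add: lpnorm_scale)
  also have "\<dots> \<le> 1 * lpnorm p h"
    using t by (intro mult_right_mono) auto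
  finally have "L * lpnorm p (y - x) \<le> L * lpnorm p h"
    using L_pos by (intro mult_left_mono) auto
  then have Ny: "N y \<le> N x + L * lpnorm p h"
    using N_le[OF y x] by linarith
  have "norm w * norm w = w \<bullet> F z - w \<bullet> F x"
    by (simp add: w_def inner_diff_right[symmetric] norm_eq_sqrt_inner)
  also have "\<dots> \<le> norm w * norm (F' y h)"
    unfolding t(3) y_def by (rule norm_cauchy_schwarz)
  finally have "norm w \<le> norm (F' y h)"
    using False by (simp add: w_def)
  also have "\<dots> \<le> N y * lpnorm p h"
    by (rule F'_bound[OF y h])
  also have "\<dots> \<le> (N x + L * lpnorm p h) * lpnorm p h"
    by (intro mult_right_mono Ny) auto
  finally show ?thesis
    by (simp add: w_def h_def)
qed

lemma grad_lq:
  assumes x: "x \<in> lp p"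
  shows "grad x \<in> lp q"
    and "lpnorm q (grad x) \<le> norm (F x - yd) * N x + \<alpha> * lpnorm p x powr (p - 1)"
    and "\<And>h. h \<in> lp p \<Longrightarrow> pairing (grad x) h = (F x - yd) \<bullet> F' x h + \<alpha> * pairing (duality_map p x) h"
proof -
  note adj = lp_adjoint[OF F'_linear[OF x], where w = "F x - yd"]
  note J = duality_map_lp[OF x]
  have q: "1 \<le> q" "q > 0" using q_ge by auto
  have eq: "grad x = lp_adjoint p q (F' x) (F x - yd) + (\<lambda>i. \<alpha> * duality_map p x i)"
    by (auto simp: tikhonov_grad_def)
  show "grad x \<in> lp q"
    unfolding eq by (intro lp_add_Minkowski q adj lp_scale J)
  have "lpnorm q (grad x) \<le> lpnorm q (lp_adjoint p q (F' x) (F x - yd)) + lpnorm q (\<lambda>i. \<alpha> * duality_map p x i)"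
    unfolding eq by (intro lp_add_Minkowski q adj lp_scale J)
  then show "lpnorm q (grad x) \<le> norm (F x - yd) * N x + \<alpha> * lpnorm p x powr (p - 1)"
    using adj(2) J \<alpha>_pos q by (simp add: lpnorm_scale)
  show "pairing (grad x) h = (F x - yd) \<bullet> F' x h + \<alpha> * pairing (duality_map p x) h" if "h \<in> lp p" for h
    unfolding tikhonov_grad_def using pairing_lincomb_left[OF adj(1) J(1) that] adj(3)[OF that] by simp
qed

text \<open>The square is expanded around the residual F x - yd, and the gradient removes the term
  linear in F' x. Only the last inner product can be negative; it pairs the residual with the
  linearization error.\<close>

lemma tikhonov_expansion:
  assumes x: "x \<in> lp p" and z: "z \<in> lp p"
  shows "\<Phi> z - \<Phi> x - pairing (grad x) (z - x)
    = \<alpha> * bregman p z x + 1 / 2 * (norm (F z - F x))\<^sup>2 + (F x - yd) \<bullet> (F z - F x - F' x (z - x))"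
proof -
  have "(norm (F z - yd))\<^sup>2 = (norm ((F x - yd) + (F z - F x)))\<^sup>2"
    by (simp add: algebra_simps)
  also have "\<dots> = (norm (F x - yd))\<^sup>2 + 2 * ((F x - yd) \<bullet> (F z - F x)) + (norm (F z - F x))\<^sup>2"
    unfolding power2_norm_eq_inner by (simp add: algebra_simps inner_commute)
  finally have "(norm (F z - yd))\<^sup>2 = \<dots>" .
  then show ?thesis
    using grad_lq(3)[OF x lp_diff[OF z x]]
    by (simp add: tikhonov_def bregman_def fp_def inner_diff_right algebra_simps)
qed

lemma linearization_error:
  assumes x: "x \<in> lp p" and z: "z \<in> lp p"
  shows "\<bar>(F x - yd) \<bullet> (F z - F x - F' x (z - x))\<bar> \<le> norm (F x - yd) * (c * bregman p z x)"
  using Cauchy_Schwarz_ineq2[of "F x - yd" "F z - F x - F' x (z - x)"]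
    mult_left_mono[OF c[OF z x] norm_ge_zero, of "F x - yd"]
  by linarith

text \<open>The square is dropped and the linearization error is absorbed. Thus \<Phi> behaves like
  a function strongly convex relative to \<open>fp\<close> wherever c times the residual norm stays
  below \<alpha>.\<close>

lemma tikhonov_lower:
  assumes x: "x \<in> lp p" and z: "z \<in> lp p"
  shows "(\<alpha> - c * norm (F x - yd)) * bregman p z x \<le> \<Phi> z - \<Phi> x - pairing (grad x) (z - x)"
proof -
  have "- (norm (F x - yd) * (c * bregman p z x)) \<le> (F x - yd) \<bullet> (F z - F x - F' x (z - x))"
    using linearization_error[OF assms] by linarith
  moreover have "0 \<le> 1 / 2 * (norm (F z - F x))\<^sup>2"
    by simp
  moreover have "(\<alpha> - c * norm (F x - yd)) * bregman p z x
      = \<alpha> * bregman p z x - norm (F x - yd) * (c * bregman p z x)"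
    by (simp add: algebra_simps)
  ultimately show ?thesis
    using tikhonov_expansion[OF assms] by linarith
qed

text \<open>Relative smoothness on bounded sets. The term that needs care is the square of F z - F
  x: its linear part is controlled by \<parallel>z - x\<parallel>^2 and hence by
  \<open>bregman_lower\<close>, its remainder by (c d)^2 \<le> c^2 D d, since the Bregman distance d
  is bounded by D there.\<close>

lemma tikhonov_upper:
  "\<exists>\<Lambda>>0. \<forall>x\<in>lp p. \<forall>z\<in>lp p. lpnorm p x \<le> R \<longrightarrow> lpnorm p z \<le> R \<longrightarrow>
    \<Phi> z - \<Phi> x - pairing (grad x) (z - x) \<le> \<Lambda> * bregman p z x"
proof -
  \<comment> \<open>R1 is positive for every real R. On the ball of radius R1, B bounds the
    derivative, E the residual and D the Bregman distance, while \<kappa> is the convexity constant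
    for two points of it.\<close>
  define R1 where "R1 = \<bar>R\<bar> + 1"
  define B where "B = N 0 + L * R1"
  define E where "E = norm (F 0 - yd) + (N 0 + L * R1) * R1"
  define \<kappa> where "\<kappa> = (p - 1) / 2 * (2 * R1) powr (p - 2)"
  define D where "D = ct * (2 * R1) powr p"
  have R1: "R1 > 0" by (simp add: R1_def)
  have \<kappa>: "\<kappa> > 0" using p1 R1 by (simp add: \<kappa>_def)
  have B: "B \<ge> 0" using N_nonneg[of 0] L_pos R1 by (simp add: B_def)
  have D: "D \<ge> 0" using ct_pos by (simp add: D_def)
  have E: "E \<ge> 0" using B R1 by (simp add: E_def B_def)
  define \<Lambda> where "\<Lambda> = \<alpha> + B\<^sup>2 / \<kappa> + c\<^sup>2 * D + E * c"
  have "\<Lambda> > 0"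
    unfolding \<Lambda>_def using \<alpha>_pos B \<kappa> D E c_pos by (intro add_pos_nonneg) auto
  moreover have "\<Phi> z - \<Phi> x - pairing (grad x) (z - x) \<le> \<Lambda> * bregman p z x"
    if x: "x \<in> lp p" "lpnorm p x \<le> R" and z: "z \<in> lp p" "lpnorm p z \<le> R" for x z
  proof -
    define d where "d = bregman p z x"
    have d0: "d \<ge> 0" unfolding d_def by (intro bregman_nonneg x z)
    have xR: "lpnorm p x \<le> R1" and zR: "lpnorm p z \<le> R1"
      using x z by (auto simp: R1_def)
    have LxR: "L * lpnorm p x \<le> L * R1"
      using xR L_pos by (intro mult_left_mono) auto
    have NxB: "N x \<le> B"
      using N_le[OF x(1) lp_zero] LxR by (simp add: B_def)
    have FxE: "norm (F x - yd) \<le> E"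
    proof -
      have "norm (F x - F 0) \<le> (N 0 + L * lpnorm p x) * lpnorm p x"
        using F_Lipschitz[OF lp_zero x(1)] by simp
      also have "\<dots> \<le> (N 0 + L * R1) * R1"
        using xR LxR N_nonneg[of 0] L_pos R1 by (intro mult_mono) auto
      finally show ?thesis
        using norm_triangle_ineq[of "F x - F 0" "F 0 - yd"] by (simp add: E_def)
    qed
    have zx: "z - x \<in> lp p" by (intro lp_diff z x)
    have conv: "\<kappa> * (lpnorm p (z - x))\<^sup>2 \<le> d"
      unfolding \<kappa>_def d_def using xR zR R1 by (intro bregman_lower x z) auto
    have dD: "d \<le> D"
    proof -
      have "lpnorm p (x - z) \<le> 2 * R1"
        using lp_diff_Minkowski(2)[OF one_le_p x(1) z(1)] xR zR by linarith
      then have "ct * lpnorm p (x - z) powr p \<le> D"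
        unfolding D_def using ct_pos p1 by (intro mult_left_mono powr_mono2) auto
      then show ?thesis
        using ct[OF x(1) z(1)] by (simp add: d_def)
    qed
    have "norm (F z - F x) \<le> B * lpnorm p (z - x) + c * d"
    proof -
      have "norm (F z - F x) \<le> norm (F' x (z - x)) + norm (F z - F x - F' x (z - x))"
        by (rule norm_triangle_sub)
      also have "\<dots> \<le> N x * lpnorm p (z - x) + c * d"
        unfolding d_def by (intro add_mono F'_bound c x z zx)
      also have "\<dots> \<le> B * lpnorm p (z - x) + c * d"
        using NxB by (intro add_right_mono mult_right_mono) auto
      finally show ?thesis .
    qed
    then have "(norm (F z - F x))\<^sup>2 \<le> (B * lpnorm p (z - x) + c * d)\<^sup>2"
      by (intro power_mono) auto
    also have "\<dots> \<le> 2 * ((B * lpnorm p (z - x))\<^sup>2 + (c * d)\<^sup>2)"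
      using sum_squares_bound[of "B * lpnorm p (z - x)" "c * d"] by (simp add: power2_sum)
    finally have "1 / 2 * (norm (F z - F x))\<^sup>2 \<le> B\<^sup>2 * (lpnorm p (z - x))\<^sup>2 + c\<^sup>2 * (d * d)"
      by (simp add: power_mult_distrib power2_eq_square[of d])
    also have "\<dots> \<le> B\<^sup>2 * (d / \<kappa>) + c\<^sup>2 * (D * d)"
      using conv \<kappa> dD d0 by (intro add_mono mult_left_mono mult_right_mono) (auto simp: field_simps)
    finally have "1 / 2 * (norm (F z - F x))\<^sup>2 \<le> (B\<^sup>2 / \<kappa> + c\<^sup>2 * D) * d"
      by (simp add: algebra_simps)
    moreover have "(F x - yd) \<bullet> (F z - F x - F' x (z - x)) \<le> E * c * d"
    proof -
      have "norm (F x - yd) * (c * d) \<le> E * (c * d)"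
        using FxE c_pos d0 by (intro mult_right_mono) auto
      then show ?thesis
        using linearization_error[OF x(1) z(1)] by (simp add: d_def)
    qed
    moreover have "\<Lambda> * d = \<alpha> * d + (B\<^sup>2 / \<kappa> + c\<^sup>2 * D) * d + E * c * d"
      by (simp add: \<Lambda>_def algebra_simps)
    ultimately show ?thesis
      using tikhonov_expansion[OF x(1) z(1)] unfolding d_def[symmetric] by linarith
  qed
  ultimately show ?thesis by blast
qed

lemma grad_bounded: "\<exists>G>0. \<forall>x\<in>lp p. lpnorm p x \<le> R \<longrightarrow> lpnorm q (grad x) \<le> G"
proof -
  define R1 where "R1 = \<bar>R\<bar> + 1"
  define B where "B = N 0 + L * R1"
  define E where "E = norm (F 0 - yd) + B * R1"
  have R1: "R1 > 0" by (simp add: R1_def)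
  have B: "B \<ge> 0" using N_nonneg[of 0] L_pos R1 by (simp add: B_def)
  have E: "E \<ge> 0" using B R1 by (simp add: E_def)
  define G where "G = E * B + \<alpha> * R1 powr (p - 1)"
  have "G > 0"
    unfolding G_def using E B \<alpha>_pos R1 by (intro add_nonneg_pos) auto
  moreover have "lpnorm q (grad x) \<le> G" if x: "x \<in> lp p" "lpnorm p x \<le> R" for x
  proof -
    have xR: "lpnorm p x \<le> R1"
      using x by (auto simp: R1_def)
    have LxR: "N 0 + L * lpnorm p x \<le> B"
      unfolding B_def using xR L_pos by (intro add_mono mult_left_mono) auto
    have NxB: "N x \<le> B"
      using N_le[OF x(1) lp_zero] LxR by simp
    have "norm (F x - F 0) \<le> (N 0 + L * lpnorm p x) * lpnorm p x"
      using F_Lipschitz[OF lp_zero x(1)] by simp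
    also have "\<dots> \<le> B * R1"
      using xR LxR B by (intro mult_mono) auto
    finally have FxE: "norm (F x - yd) \<le> E"
      using norm_triangle_ineq[of "F x - F 0" "F 0 - yd"] by (simp add: E_def)
    have "norm (F x - yd) * N x + \<alpha> * lpnorm p x powr (p - 1) \<le> G"
      unfolding G_def using FxE NxB E N_nonneg[OF x(1)] xR \<alpha>_pos p1
      by (intro add_mono mult_mono powr_mono2) auto
    then show ?thesis
      using grad_lq(2)[OF x(1)] by linarith
  qed
  ultimately show ?thesis by blast
qed

end

section \<open>The dual iteration\<close>

context tikhonov_functional
begin

text \<open>The norm bound holds because \<open>duality_map q\<close> raises the dual norm to the
  power q - 1; it keeps steps of bounded length from bounded starting points bounded.\<close>

lemma dual_step_lp:
  assumes x: "x \<in> lp p"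
  shows "dual_step p q (grad x) t x \<in> lp p"
    and "duality_map p (dual_step p q (grad x) t x) = (\<lambda>i. duality_map p x i - t * grad x i)"
    and "0 \<le> t \<Longrightarrow> lpnorm p (dual_step p q (grad x) t x)
      \<le> (lpnorm p x powr (p - 1) + t * lpnorm q (grad x)) powr (q - 1)"
proof -
  define \<xi> where "\<xi> = (\<lambda>i. duality_map p x i - t * grad x i)"
  have q: "1 \<le> q" "0 < q" using q_ge by auto
  have eq: "\<xi> = duality_map p x - (\<lambda>i. t * grad x i)"
    by (auto simp: \<xi>_def)
  note J = duality_map_lp[OF x] and g = grad_lq(1)[OF x]
  have \<xi>: "\<xi> \<in> lp q"
    unfolding eq by (intro lp_diff_Minkowski q J lp_scale g)
  have w: "dual_step p q (grad x) t x = duality_map q \<xi>"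
    by (simp add: dual_step_def \<xi>_def)
  show "dual_step p q (grad x) t x \<in> lp p"
    unfolding w by (rule duality_map_lq[OF \<xi>])
  show "duality_map p (dual_step p q (grad x) t x) = (\<lambda>i. duality_map p x i - t * grad x i)"
    unfolding w duality_map_inverse by (rule \<xi>_def)
  assume t: "0 \<le> t"
  have "lpnorm q \<xi> \<le> lpnorm q (duality_map p x) + lpnorm q (\<lambda>i. t * grad x i)"
    unfolding eq by (intro lp_diff_Minkowski q J lp_scale g)
  also have "\<dots> = lpnorm p x powr (p - 1) + t * lpnorm q (grad x)"
    using J g t q by (simp add: lpnorm_scale)
  finally show "lpnorm p (dual_step p q (grad x) t x)
      \<le> (lpnorm p x powr (p - 1) + t * lpnorm q (grad x)) powr (q - 1)"
    unfolding w duality_map_lq[OF \<xi>] using q by (intro powr_mono2) auto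
qed

text \<open>For t \<Lambda> \<le> 1 relative smoothness gives t (\<Phi> w - \<Phi> x - \<langle>grad
  x, w - x\<rangle>) \<le> D(w, x). This is exactly the term D(w, x) in the three-point identity,
  which therefore drops out.\<close>

lemma dual_step_descent:
  "\<exists>\<Lambda>>0. \<exists>R'>0. \<forall>x\<in>lp p. \<forall>t w. lpnorm p x \<le> R \<longrightarrow> 0 \<le> t \<longrightarrow> t \<le> 1 \<longrightarrow> t * \<Lambda> \<le> 1 \<longrightarrow>
     w = dual_step p q (grad x) t x \<longrightarrow>
     lpnorm p w \<le> R' \<and> bregman p x w \<le> t * (\<Phi> x - \<Phi> w) \<and>
     (\<forall>u\<in>lp p. t * pairing (grad x) (x - u) \<le> bregman p u x - bregman p u w + t * (\<Phi> x - \<Phi> w))"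
proof -
  obtain G where G: "G > 0" "\<And>x. x \<in> lp p \<Longrightarrow> lpnorm p x \<le> R \<Longrightarrow> lpnorm q (grad x) \<le> G"
    using grad_bounded by blast
  \<comment> \<open>The bound must hold for both ends of the step, since \<Lambda> is the smoothness
    constant on the ball of radius R'. The restriction t \<le> 1 makes R' independent of \<Lambda>
    and so avoids a circular choice.\<close>
  define R' where "R' = (\<bar>R\<bar> powr (p - 1) + G) powr (q - 1) + \<bar>R\<bar> + 1"
  have R': "R' > 0" "R \<le> R'"
    by (auto simp: R'_def intro!: add_nonneg_pos add_nonneg_nonneg)
       (smt (verit) powr_ge_zero)
  obtain \<Lambda> where \<Lambda>: "\<Lambda> > 0" "\<And>x z. x \<in> lp p \<Longrightarrow> z \<in> lp p \<Longrightarrow> lpnorm p x \<le> R' \<Longrightarrow> lpnorm p z \<le> R' \<Longrightarrow>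
      \<Phi> z - \<Phi> x - pairing (grad x) (z - x) \<le> \<Lambda> * bregman p z x"
    using tikhonov_upper by blast
  have "lpnorm p w \<le> R' \<and> bregman p x w \<le> t * (\<Phi> x - \<Phi> w) \<and>
     (\<forall>u\<in>lp p. t * pairing (grad x) (x - u) \<le> bregman p u x - bregman p u w + t * (\<Phi> x - \<Phi> w))"
    if x: "x \<in> lp p" "lpnorm p x \<le> R" and t: "0 \<le> t" "t \<le> 1" "t * \<Lambda> \<le> 1"
      and w_eq: "w = dual_step p q (grad x) t x" for x t w
  proof -
    note ws = dual_step_lp[OF x(1), of t, folded w_eq]
    note w = ws(1)
    have "t * lpnorm q (grad x) \<le> 1 * G"
      using t G x by (intro mult_mono) auto
    moreover have "lpnorm p x powr (p - 1) \<le> \<bar>R\<bar> powr (p - 1)"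
      using x(2) p1 by (intro powr_mono2) auto
    ultimately have "(lpnorm p x powr (p - 1) + t * lpnorm q (grad x)) powr (q - 1) \<le> (\<bar>R\<bar> powr (p - 1) + G) powr (q - 1)"
      using q_ge t by (intro powr_mono2) auto
    then have wR: "lpnorm p w \<le> R'"
      using ws(3)[OF t(1)] by (simp add: R'_def)
    have three: "bregman p u x - bregman p u w - bregman p w x = t * pairing (grad x) (w - u)" if u: "u \<in> lp p" for u
    proof -
      have "bregman p u x - bregman p u w - bregman p w x = pairing (\<lambda>i. duality_map p x i - duality_map p w i) (w - u)"
        by (rule three_point_identity[OF x(1) w u])
      also have "(\<lambda>i. duality_map p x i - duality_map p w i) = (\<lambda>i. t * grad x i)"
        by (simp add: ws(2))
      also have "pairing (\<lambda>i. t * grad x i) (w - u) = t * pairing (grad x) (w - u)"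
        using suminf_mult[OF pairing_Holder(1)[OF grad_lq(1)[OF x(1)] lp_diff[OF w u]], of t]
        by (simp add: pairing_def mult.assoc)
      finally show ?thesis .
    qed
    have "t * (\<Phi> w - \<Phi> x - pairing (grad x) (w - x)) \<le> t * (\<Lambda> * bregman p w x)"
      using x R' by (intro mult_left_mono \<Lambda> w wR t) auto
    also have "\<dots> = t * \<Lambda> * bregman p w x"
      by simp
    also have "\<dots> \<le> 1 * bregman p w x"
      by (intro mult_right_mono t bregman_nonneg x w)
    finally have up: "t * (\<Phi> w - \<Phi> x) - t * pairing (grad x) (w - x) \<le> bregman p w x"
      by (simp add: algebra_simps)
    \<comment> \<open>This is the case u = x of the identity, where D(x, x) = 0.\<close>
    have "bregman p x w \<le> t * (\<Phi> x - \<Phi> w)"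
      using three[OF x(1)] up bregman_self[OF x(1)] by (simp add: algebra_simps)
    moreover have "t * pairing (grad x) (x - u) \<le> bregman p u x - bregman p u w + t * (\<Phi> x - \<Phi> w)"
      if u: "u \<in> lp p" for u
    proof -
      have "pairing (grad x) (x - u) = pairing (grad x) (w - u) - pairing (grad x) (w - x)"
        using x u w grad_lq(1)[OF x(1)] by (simp add: pairing_diff_right)
      then have "t * pairing (grad x) (x - u) = t * pairing (grad x) (w - u) - t * pairing (grad x) (w - x)"
        by (simp add: right_diff_distrib)
      moreover have "t * (\<Phi> x - \<Phi> w) = - (t * (\<Phi> w - \<Phi> x))"
        by (simp add: right_diff_distrib)
      ultimately show ?thesis
        using three[OF u] up by linarith
    qed
    ultimately show ?thesis
      using wR by blast
  qed
  then show ?thesis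
    using \<Lambda>(1) R'(1) by blast
qed

lemma line_min_le:
  assumes "0 \<le> t"
  shows "line_min p q F F' yd \<alpha> x \<le> \<Phi> (dual_step p q (grad x) t x)"
  unfolding line_min_def
proof (rule cINF_lower)
  show "bdd_below ((\<lambda>t. \<Phi> (dual_step p q (grad x) t x)) ` {0..})"
    using \<alpha>_pos p1 by (intro bdd_belowI2[where m = 0]) (simp add: tikhonov_def)
qed (use assms in auto)

text \<open>The explicit constants of the step size are abstracted to \<eta> and \<nu>, of which
  only positivity matters. M is chosen before the starting point and works on the whole Bregman
  ball.\<close>

lemma dual_iteration_convergence:
  assumes xm: "tikhonov_minimizer p F yd \<alpha> xm"
    and pos: "r > 0" "\<mu> > 0" "\<eta> > 0" "\<nu> > 0"
    and ball: "bregman_ball p xm d \<subseteq> lp_cball p xm r"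
    and mono: "\<And>x. x \<in> bregman_ball p xm d \<Longrightarrow>
      \<Phi> x - \<Phi> xm + \<mu> * bregman p xm x \<le> pairing (grad x) (x - xm)"
    and \<beta>: "\<And>M x. \<beta> M x = min (\<eta> * min 1 (\<nu> * (\<Phi> x - line_min p q F F' yd \<alpha> x)) / (lpnorm q (grad x))\<^sup>2)
      (1 / (2 * M))"
  shows "\<exists>M>0. \<forall>x0\<in>bregman_ball p xm d. lp_tendsto p (dual_iterates p q grad (\<beta> M) x0) xm"
proof -
  have xml: "xm \<in> lp p" and min: "\<And>z. z \<in> lp p \<Longrightarrow> \<Phi> xm \<le> \<Phi> z"
    using xm by (auto simp: tikhonov_minimizer_def)
  define R where "R = lpnorm p xm + r"
  have R: "R > 0"
    unfolding R_def using pos by (intro add_nonneg_pos) auto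
  obtain G where G: "G > 0" "\<And>x. x \<in> lp p \<Longrightarrow> lpnorm p x \<le> R \<Longrightarrow> lpnorm q (grad x) \<le> G"
    using grad_bounded by blast
  obtain \<Lambda> R' where \<Lambda>: "\<Lambda> > 0" "R' > 0" and desc: "\<And>x t w. x \<in> lp p \<Longrightarrow> lpnorm p x \<le> R \<Longrightarrow> 0 \<le> t \<Longrightarrow> t \<le> 1 \<Longrightarrow>
     t * \<Lambda> \<le> 1 \<Longrightarrow> w = dual_step p q (grad x) t x \<Longrightarrow>
     lpnorm p w \<le> R' \<and> bregman p x w \<le> t * (\<Phi> x - \<Phi> w) \<and>
     (\<forall>u\<in>lp p. t * pairing (grad x) (x - u) \<le> bregman p u x - bregman p u w + t * (\<Phi> x - \<Phi> w))"
    using dual_step_descent[of R] by blast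
  \<comment> \<open>With T = 1 / (2 M) every t in [0, T] meets both requirements of the descent
    lemma, t \<le> 1 and t \<Lambda> \<le> 1.\<close>
  define M where "M = max 1 \<Lambda>"
  define T where "T = 1 / (2 * M)"
  have M: "M > 0" by (simp add: M_def)
  have T: "T > 0" using M by (simp add: T_def)
  have tT: "t \<le> 1" "t * \<Lambda> \<le> 1" if "0 \<le> t" "t \<le> T" for t
  proof -
    have "T \<le> 1" "T * \<Lambda> \<le> 1"
      using \<Lambda> by (auto simp: T_def M_def divide_le_eq max_def)
    then show "t \<le> 1" using that by simp
    have "t * \<Lambda> \<le> T * \<Lambda>"
      using that \<Lambda> by (intro mult_right_mono) auto
    then show "t * \<Lambda> \<le> 1" using \<open>T * \<Lambda> \<le> 1\<close> by simp
  qed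
  have ballD: "x \<in> lp p" "lpnorm p (x - xm) \<le> r" "lpnorm p x \<le> R" if "x \<in> bregman_ball p xm d" for x
  proof -
    have "x \<in> lp_cball p xm r" using ball that by blast
    then show 1: "x \<in> lp p" "lpnorm p (x - xm) \<le> r" by (auto simp: lp_cball_def)
    then show "lpnorm p x \<le> R"
      using lpnorm_le_add_diff[OF one_le_p _ xml, of x] by (simp add: R_def)
  qed
  \<comment> \<open>In the descent inequality at u = xm the value \<Phi> x cancels against
    \<open>mono\<close>, and \<Phi> xm \<le> \<Phi> w disposes of the rest. The distance to xm
    cannot grow, so the ball is invariant.\<close>
  have step: "dual_step p q (grad x) t x \<in> bregman_ball p xm d"
      "bregman p xm (dual_step p q (grad x) t x) \<le> bregman p xm x - t * \<mu> * bregman p xm x"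
    if x: "x \<in> bregman_ball p xm d" and t: "0 \<le> t" "t \<le> T" for x t
  proof -
    define w where "w = dual_step p q (grad x) t x"
    note xb = ballD[OF x]
    have w: "w \<in> lp p"
      unfolding w_def by (rule dual_step_lp[OF xb(1)])
    have "t * pairing (grad x) (x - xm) \<le> bregman p xm x - bregman p xm w + t * (\<Phi> x - \<Phi> w)"
      using desc[OF xb(1,3) t(1) tT[OF t] w_def] xml by blast
    moreover have "t * (\<Phi> x - \<Phi> xm + \<mu> * bregman p xm x) \<le> t * pairing (grad x) (x - xm)"
      by (intro mult_left_mono mono x t)
    moreover have "t * \<Phi> xm \<le> t * \<Phi> w"
      by (intro mult_left_mono min w t)
    ultimately show le: "bregman p xm (dual_step p q (grad x) t x) \<le> bregman p xm x - t * \<mu> * bregman p xm x"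
      unfolding w_def[symmetric] by (simp add: algebra_simps)
    have "0 \<le> t * \<mu> * bregman p xm x"
      using t pos by (intro mult_nonneg_nonneg bregman_nonneg xml xb) auto
    then show "dual_step p q (grad x) t x \<in> bregman_ball p xm d"
      using le x w unfolding bregman_ball_def w_def[symmetric] by simp
  qed
  \<comment> \<open>The fixed step T is one candidate in the line minimization, so the decrease
    along the ray is at least that of this step.\<close>
  have decrease: "bregman p x (dual_step p q (grad x) T x) \<le> T * (\<Phi> x - line_min p q F F' yd \<alpha> x)"
    if x: "x \<in> bregman_ball p xm d" for x
  proof -
    note xb = ballD[OF x]
    have "bregman p x (dual_step p q (grad x) T x) \<le> T * (\<Phi> x - \<Phi> (dual_step p q (grad x) T x))"
      using desc[OF xb(1,3) less_imp_le[OF T] tT[OF less_imp_le[OF T] order_refl] refl] by blast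
    also have "\<dots> \<le> T * (\<Phi> x - line_min p q F F' yd \<alpha> x)"
      using T line_min_le[of T x] by (intro mult_left_mono) auto
    finally show ?thesis .
  qed
  \<comment> \<open>For a vanishing gradient the quotient has the value 0, so the step size is 0 and
    the iterate stays put.\<close>
  have \<beta>0: "0 \<le> \<beta> M x" if x: "x \<in> bregman_ball p xm d" for x
  proof -
    note xb = ballD[OF x]
    have "0 \<le> bregman p x (dual_step p q (grad x) T x)"
      by (intro bregman_nonneg xb dual_step_lp)
    then have "0 \<le> \<Phi> x - line_min p q F F' yd \<alpha> x"
      using decrease[OF x] T by (meson less_le_not_le order_trans zero_le_mult_iff)
    then show ?thesis
      unfolding \<beta> using pos M by auto
  qed
  have \<beta>T: "\<beta> M x \<le> T" for x
    by (simp add: \<beta> T_def)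
  have lower: "\<exists>b>0. \<forall>x\<in>bregman_ball p xm d. \<epsilon> \<le> bregman p xm x \<longrightarrow> b \<le> \<beta> M x" if \<epsilon>: "\<epsilon> > 0" for \<epsilon>
  proof -
    \<comment> \<open>A chain of lower bounds valid while D(xm, x) \<ge> \<epsilon>: g0 for the
      gradient norm, h0 for the primal length of the trial step T, \<kappa> h0^2 / T for the line
      decrease, b1 for the inner minimum and b for the step size.\<close>
    define g0 where "g0 = \<mu> * \<epsilon> / r"
    define h0 where "h0 = (T * g0 / 2) powr (q - 1)"
    define \<kappa> where "\<kappa> = (p - 1) / 2 * (R + R') powr (p - 2)"
    define b1 where "b1 = min 1 (\<nu> * (\<kappa> * h0\<^sup>2 / T))"
    define b where "b = min (\<eta> * b1 / G\<^sup>2) T"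
    have g0: "g0 > 0" using pos \<epsilon> by (simp add: g0_def)
    have h0: "h0 > 0" using g0 T by (simp add: h0_def)
    have \<kappa>: "\<kappa> > 0" using p1 R \<Lambda> by (simp add: \<kappa>_def)
    have b1: "b1 > 0" using pos \<kappa> h0 T by (simp add: b1_def)
    have "b > 0" using b1 pos G T by (simp add: b_def)
    moreover have "b \<le> \<beta> M x" if x: "x \<in> bregman_ball p xm d" and D: "\<epsilon> \<le> bregman p xm x" for x
    proof -
      note xb = ballD[OF x]
      define n where "n = lpnorm q (grad x)"
      define w where "w = dual_step p q (grad x) T x"
      have w: "w \<in> lp p" unfolding w_def by (rule dual_step_lp[OF xb(1)])
      have "\<mu> * \<epsilon> \<le> \<mu> * bregman p xm x"
        using D pos by (intro mult_left_mono) auto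
      also have "\<dots> \<le> pairing (grad x) (x - xm)"
        using mono[OF x] min[OF xb(1)] by linarith
      also have "\<dots> \<le> n * lpnorm p (x - xm)"
        using pairing_Holder(2)[OF grad_lq(1)[OF xb(1)] lp_diff[OF xb(1) xml]] by (simp add: n_def)
      also have "\<dots> \<le> n * r"
        using xb by (intro mult_left_mono) (auto simp: n_def)
      finally have n0: "g0 \<le> n"
        using pos by (simp add: g0_def divide_le_eq)
      have nG: "n \<le> G" unfolding n_def by (intro G xb)
      \<comment> \<open>In the dual space the trial step has length T n. Hoelder continuity of the
        duality map with exponent p - 1 converts this into a lower bound for \<parallel>x -
        w\<parallel>, and the power q - 1 undoes the exponent.\<close>
      have "T * n = lpnorm q (\<lambda>i. duality_map p x i - duality_map p w i)"
        using lpnorm_scale[OF _ grad_lq(1)[OF xb(1)], of T] T q_ge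
        by (simp add: w_def dual_step_lp(2)[OF xb(1)] n_def)
      also have "\<dots> \<le> 2 * lpnorm p (x - w) powr (p - 1)"
        by (intro duality_map_Hoelder xb w)
      finally have "T * n / 2 \<le> lpnorm p (x - w) powr (p - 1)"
        by simp
      moreover have "T * g0 \<le> T * n"
        using n0 T by (intro mult_left_mono) auto
      ultimately have "T * g0 / 2 \<le> lpnorm p (x - w) powr (p - 1)"
        by linarith
      then have "h0 \<le> (lpnorm p (x - w) powr (p - 1)) powr (q - 1)"
        unfolding h0_def using T g0 q_ge by (intro powr_mono2) auto
      also have "\<dots> = lpnorm p (x - w)"
        by (simp add: powr_powr pq_swap)
      finally have "\<kappa> * h0\<^sup>2 \<le> \<kappa> * (lpnorm p (x - w))\<^sup>2"
        using \<kappa> h0 by (intro mult_left_mono power_mono) auto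
      also have "\<dots> \<le> bregman p x w"
      proof -
        have "lpnorm p w \<le> R'"
          using desc[OF xb(1,3) less_imp_le[OF T] tT[OF less_imp_le[OF T] order_refl] w_def] by blast
        then show ?thesis
          unfolding \<kappa>_def using xb R \<Lambda> by (intro bregman_lower w) auto
      qed
      also have "\<dots> \<le> T * (\<Phi> x - line_min p q F F' yd \<alpha> x)"
        unfolding w_def by (rule decrease[OF x])
      finally have "\<kappa> * h0\<^sup>2 / T \<le> \<Phi> x - line_min p q F F' yd \<alpha> x"
        using T by (simp add: divide_le_eq mult.commute)
      then have "\<nu> * (\<kappa> * h0\<^sup>2 / T) \<le> \<nu> * (\<Phi> x - line_min p q F F' yd \<alpha> x)"
        using pos by (intro mult_left_mono) auto
      then have b1le: "b1 \<le> min 1 (\<nu> * (\<Phi> x - line_min p q F F' yd \<alpha> x))"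
        unfolding b1_def by (intro min.mono) auto
      have "\<eta> * b1 / G\<^sup>2 \<le> \<eta> * min 1 (\<nu> * (\<Phi> x - line_min p q F F' yd \<alpha> x)) / n\<^sup>2"
        using b1le b1 pos g0 n0 nG by (intro frac_le mult_left_mono power_mono mult_nonneg_nonneg) auto
      then show ?thesis
        unfolding b_def \<beta> n_def T_def by (intro min.mono) auto
    qed
    ultimately show ?thesis by blast
  qed
  have "lp_tendsto p (dual_iterates p q grad (\<beta> M) x0) xm" if x0: "x0 \<in> bregman_ball p xm d" for x0
  proof -
    define X where "X = dual_iterates p q grad (\<beta> M) x0"
    define D where "D k = bregman p xm (X k)" for k
    have XSuc: "X (Suc k) = dual_step p q (grad (X k)) (\<beta> M (X k)) (X k)" for k
      by (simp add: X_def Let_def)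
    have X: "X k \<in> bregman_ball p xm d" for k
    proof (induction k)
      case 0
      show ?case using x0 by (simp add: X_def)
    next
      case (Suc k)
      then show ?case unfolding XSuc by (intro step \<beta>0 \<beta>T)
    qed
    note Xb = ballD[OF X]
    have D0: "0 \<le> D k" for k
      unfolding D_def by (intro bregman_nonneg xml Xb)
    have DSuc: "D (Suc k) \<le> D k - \<beta> M (X k) * \<mu> * D k" for k
      unfolding D_def XSuc by (intro step X \<beta>0 \<beta>T)
    have "D (Suc k) \<le> D k" for k
    proof -
      have "0 \<le> \<beta> M (X k) * \<mu> * D k"
        using pos by (intro mult_nonneg_nonneg \<beta>0 X D0) auto
      then show ?thesis using DSuc[of k] by linarith
    qed
    then have dec: "D m \<le> D k" if "k \<le> m" for k m
      using that by (rule lift_Suc_antimono_le)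
    \<comment> \<open>Otherwise each step would lower D by at least b \<mu> \<epsilon>, making it
      negative eventually.\<close>
    have small: "\<exists>k. D k < \<epsilon>" if \<epsilon>: "\<epsilon> > 0" for \<epsilon>
    proof (rule ccontr)
      assume "\<not> (\<exists>k. D k < \<epsilon>)"
      then have ge: "\<epsilon> \<le> D k" for k by (meson not_le)
      obtain b where b: "b > 0" "\<And>x. x \<in> bregman_ball p xm d \<Longrightarrow> \<epsilon> \<le> bregman p xm x \<Longrightarrow> b \<le> \<beta> M x"
        using lower[OF \<epsilon>] by blast
      have "D k \<le> D 0 - real k * (b * \<mu> * \<epsilon>)" for k
      proof (induction k)
        case (Suc k)
        have "b * \<mu> * \<epsilon> \<le> \<beta> M (X k) * \<mu> * D k"
          using b(1) b(2)[OF X] ge[of k] pos \<epsilon> \<beta>0[OF X] by (intro mult_mono) (auto simp: D_def)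
        then show ?case
          using Suc DSuc[of k] by (simp add: algebra_simps)
      qed simp
      moreover obtain k where "D 0 < real k * (b * \<mu> * \<epsilon>)"
        using reals_Archimedean3[of "b * \<mu> * \<epsilon>"] b pos \<epsilon> by auto
      ultimately show False
        using D0[of k] by (smt (verit))
    qed
    have "D \<longlonglongrightarrow> 0"
    proof (rule LIMSEQ_I)
      fix \<epsilon> :: real assume "\<epsilon> > 0"
      then obtain k where "D k < \<epsilon>" using small by blast
      then show "\<exists>k. \<forall>m\<ge>k. norm (D m - 0) < \<epsilon>"
        using dec[of k] D0 by (intro exI[of _ k]) (force intro: le_less_trans)
    qed
    \<comment> \<open>All iterates and xm lie in the ball of radius R, so one convexity constant
      turns D \<longlonglongrightarrow> 0 into norm convergence.\<close>
    define \<kappa> where "\<kappa> = (p - 1) / 2 * (R + R) powr (p - 2)"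
    have \<kappa>: "\<kappa> > 0" using p1 R by (simp add: \<kappa>_def)
    have "\<kappa> * (lpnorm p (X k - xm))\<^sup>2 \<le> D k" for k
      unfolding \<kappa>_def D_def lpnorm_minus_commute[of p "X k"] using Xb[of k] xml R pos
      by (intro bregman_lower) (auto simp: R_def)
    then have le: "lpnorm p (X k - xm) \<le> sqrt (D k / \<kappa>)" for k
      using \<kappa> by (intro real_le_rsqrt) (simp add: field_simps)
    have "(\<lambda>k. sqrt (D k / \<kappa>)) \<longlonglongrightarrow> sqrt (0 / \<kappa>)"
      using \<kappa> \<open>D \<longlonglongrightarrow> 0\<close> by (intro tendsto_intros) auto
    then have "(\<lambda>k. sqrt (D k / \<kappa>)) \<longlonglongrightarrow> 0" by simp
    then have "(\<lambda>k. lpnorm p (X k - xm)) \<longlonglongrightarrow> 0"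
      by (rule Lim_null_comparison[rotated]) (use le in auto)
    then show ?thesis
      unfolding lp_tendsto_def X_def[symmetric] using Xb xml by blast
  qed
  then show ?thesis using M by blast
qed

text \<open>At the minimizer c times the residual leaves a gap of 2 \<gamma> \<alpha> below
  \<alpha>. Moving a distance at most r away uses up at most half of it, so
  \<open>tikhonov_lower\<close> applies with the constant \<gamma> \<alpha>.\<close>

lemma local_convexity:
  assumes x: "x \<in> lp p" and xm: "xm \<in> lp p" and r: "lpnorm p (x - xm) \<le> r"
    and res: "c * norm (F xm - yd) \<le> (1 - 2 * \<gamma>) * \<alpha>"
    and K: "N xm \<le> K" and small: "c * ((K + L * r) * r) \<le> \<gamma> * \<alpha>"
  shows "\<Phi> x - \<Phi> xm + \<gamma> * \<alpha> * bregman p xm x \<le> pairing (grad x) (x - xm)"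
proof -
  have r0: "0 \<le> r" using r lpnorm_nonneg[of p "x - xm"] by linarith
  have "norm (F x - F xm) \<le> (N xm + L * lpnorm p (x - xm)) * lpnorm p (x - xm)"
    by (rule F_Lipschitz[OF xm x])
  also have "\<dots> \<le> (K + L * r) * r"
    using r r0 K L_pos N_nonneg[OF xm] by (intro mult_mono add_mono) auto
  finally have "c * norm (F x - F xm) \<le> c * ((K + L * r) * r)"
    using c_pos by (intro mult_left_mono) auto
  moreover have "c * norm (F x - yd) \<le> c * (norm (F x - F xm) + norm (F xm - yd))"
    using c_pos norm_triangle_ineq[of "F x - F xm" "F xm - yd"] by (intro mult_left_mono) auto
  ultimately have "\<gamma> * \<alpha> \<le> \<alpha> - c * norm (F x - yd)"
    using res small by (simp add: algebra_simps)
  then have "\<gamma> * \<alpha> * bregman p xm x \<le> (\<alpha> - c * norm (F x - yd)) * bregman p xm x"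
    by (intro mult_right_mono bregman_nonneg x xm)
  also have "\<dots> \<le> \<Phi> xm - \<Phi> x - pairing (grad x) (xm - x)"
    by (rule tikhonov_lower[OF x xm])
  finally show ?thesis
    using grad_lq(1)[OF x] x xm by (simp add: pairing_diff_right)
qed

text \<open>The minimality of xm is tested against xd. The difference of the penalties is D + S, and
  the source condition writes S as \<omega> paired with the derivative at xd. The linearization
  error in S costs at most c \<rho> D, which D absorbs.\<close>

lemma minimizer_residual:
  assumes xm: "tikhonov_minimizer p F yd \<alpha> xm" and xd: "xd \<in> lp p"
    and \<delta>: "norm (F xd - yd) \<le> \<delta>"
    and source: "norm \<omega> \<le> \<rho>" "duality_map p xd = lp_adjoint p q (F' xd) \<omega>" and \<rho>: "c * \<rho> \<le> 1"
  shows "norm (F xm - yd) \<le> \<delta> + 2 * \<alpha> * \<rho>"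
proof -
  have x: "xm \<in> lp p" and min: "\<Phi> xm \<le> \<Phi> xd"
    using xm xd by (auto simp: tikhonov_minimizer_def)
  define n where "n = norm (F xm - yd)"
  define D where "D = bregman p xm xd"
  have D: "0 \<le> D" unfolding D_def by (intro bregman_nonneg x xd)
  define S where "S = pairing (duality_map p xd) (xm - xd)"
  have \<delta>0: "0 \<le> \<delta>" and \<rho>0: "0 \<le> \<rho>"
    using \<delta> source(1) norm_ge_zero[of "F xd - yd"] norm_ge_zero[of \<omega>] by linarith+
  have h: "xm - xd \<in> lp p" by (intro lp_diff x xd)
  have "norm (F' xd (xm - xd)) \<le> norm (F xm - F xd) + norm (F xm - F xd - F' xd (xm - xd))"
    using norm_triangle_ineq4[of "F xm - F xd" "F xm - F xd - F' xd (xm - xd)"] by simp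
  also have "\<dots> \<le> (n + \<delta>) + c * D"
  proof (rule add_mono)
    show "norm (F xm - F xd) \<le> n + \<delta>"
      using norm_triangle_ineq4[of "F xm - yd" "F xd - yd"] \<delta> by (simp add: n_def)
    show "norm (F xm - F xd - F' xd (xm - xd)) \<le> c * D"
      unfolding D_def by (rule c[OF x xd])
  qed
  finally have "norm \<omega> * norm (F' xd (xm - xd)) \<le> \<rho> * (n + \<delta> + c * D)"
    using source(1) \<rho>0 by (intro mult_mono) auto
  moreover have "S = \<omega> \<bullet> F' xd (xm - xd)"
    using pairing_lp_adjoint[OF F'_linear[OF xd] h, of \<omega>] by (simp only: S_def source(2))
  ultimately have "- (\<rho> * (n + \<delta> + c * D)) \<le> S"
    using Cauchy_Schwarz_ineq2[of \<omega> "F' xd (xm - xd)"] by linarith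
  then have "\<alpha> * (D - \<rho> * (n + \<delta> + c * D)) \<le> \<alpha> * (D + S)"
    using \<alpha>_pos by (intro mult_left_mono) auto
  moreover have "\<alpha> * (D - \<rho> * (n + \<delta> + c * D)) = \<alpha> * ((1 - c * \<rho>) * D) - \<alpha> * \<rho> * n - \<alpha> * \<rho> * \<delta>"
    by (simp add: algebra_simps)
  moreover have "0 \<le> \<alpha> * ((1 - c * \<rho>) * D)"
    using \<alpha>_pos \<rho> D by auto
  moreover have "\<Phi> xm - \<Phi> xd = 1 / 2 * n\<^sup>2 - 1 / 2 * (norm (F xd - yd))\<^sup>2 + \<alpha> * (D + S)"
    by (simp add: tikhonov_def D_def S_def n_def bregman_def fp_def algebra_simps)
  moreover have "(norm (F xd - yd))\<^sup>2 \<le> \<delta>\<^sup>2"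
    using \<delta> by (intro power_mono) auto
  ultimately have "n\<^sup>2 - 2 * (\<alpha> * \<rho> * n) \<le> \<delta>\<^sup>2 + 2 * (\<alpha> * \<rho> * \<delta>)"
    using min by linarith
  \<comment> \<open>Completing the square: the same term (\<alpha> \<rho>)^2 is added on both
    sides.\<close>
  then have "(n - \<alpha> * \<rho>)\<^sup>2 \<le> (\<delta> + \<alpha> * \<rho>)\<^sup>2"
    by (simp add: power2_diff power2_sum algebra_simps)
  then have "n - \<alpha> * \<rho> \<le> \<delta> + \<alpha> * \<rho>"
    by (rule power2_le_imp_le) (use \<delta>0 \<rho>0 \<alpha>_pos in simp)
  then show ?thesis unfolding n_def by linarith
qed

text \<open>Minimality is tested against 0, where the penalty vanishes. The lower bound a for the
  parameter makes the estimate uniform in \<alpha>.\<close>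

lemma minimizer_norm:
  assumes xm: "tikhonov_minimizer p F yd \<alpha> xm" and a: "0 < a" "a \<le> \<alpha>"
  shows "lpnorm p xm \<le> (p / (2 * a)) powr (1 / p) * norm (F 0 - yd) powr (2 / p)"
proof -
  define n where "n = norm (F 0 - yd)"
  have "\<Phi> xm \<le> \<Phi> 0"
    using xm by (auto simp: tikhonov_minimizer_def)
  moreover have "\<Phi> 0 = 1 / 2 * n\<^sup>2"
    by (simp add: tikhonov_def n_def)
  moreover have "\<alpha> / p * lpnorm p xm powr p \<le> \<Phi> xm"
    by (simp add: tikhonov_def)
  ultimately have "\<alpha> / p * lpnorm p xm powr p \<le> 1 / 2 * n\<^sup>2"
    by linarith
  then have "lpnorm p xm powr p \<le> p / (2 * \<alpha>) * n\<^sup>2"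
    using p1 \<alpha>_pos by (simp add: field_simps)
  also have "\<dots> \<le> p / (2 * a) * n\<^sup>2"
    using a p1 by (intro mult_right_mono frac_le) auto
  finally have "(lpnorm p xm powr p) powr (1 / p) \<le> (p / (2 * a) * n\<^sup>2) powr (1 / p)"
    using p1 by (intro powr_mono2) auto
  moreover have "(n\<^sup>2) powr (1 / p) = n powr (2 / p)"
    using powr_powr[of n 2 "1 / p"] by (simp add: n_def)
  ultimately show ?thesis
    using p1 unfolding powr_mult[of _ "n\<^sup>2"] by (simp add: powr_powr n_def)
qed

end

section \<open>The prescribed radius, parameter range and step sizes\<close>

theorem theorem3p9:
  fixes p q \<delta> L c s \<rho> ct \<alpha>s A K \<gamma> \<alpha>\<^sub>j cA :: real
    and F :: "(nat \<Rightarrow> real) \<Rightarrow> 'y :: {real_inner, complete_space}"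
    and F' :: "(nat \<Rightarrow> real) \<Rightarrow> (nat \<Rightarrow> real) \<Rightarrow> 'y"
    and y yd \<omega> :: 'y
    and xdag :: "nat \<Rightarrow> real"
    and xmin :: "real \<Rightarrow> nat \<Rightarrow> real"
    and r d :: "real \<Rightarrow> real"
    and grad :: "(nat \<Rightarrow> real) \<Rightarrow> nat \<Rightarrow> real"
    and cbar :: "(nat \<Rightarrow> real) \<Rightarrow> real"
    and \<beta> :: "real \<Rightarrow> (nat \<Rightarrow> real) \<Rightarrow> real"
  assumes p: "1 < p" "p \<le> 2" and q: "1 / p + 1 / q = 1"
    and closed: "weakly_seq_closed p q F"
    and y: "y \<in> F ` lp p"
    and \<delta>: "\<delta> > 0" and yd: "norm (y - yd) \<le> \<delta>"
    and ct: "ct > 0"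
      "\<And>x z. x \<in> lp p \<Longrightarrow> z \<in> lp p \<Longrightarrow> bregman p z x \<le> ct * lpnorm p (x - z) powr p"
    and frechet: "\<And>x. x \<in> lp p \<Longrightarrow> lp_frechet p F (F' x) x"
    and L: "L > 0"
      "\<And>x z. x \<in> lp p \<Longrightarrow> z \<in> lp p \<Longrightarrow> lp_opnorm p (\<lambda>h. F' x h - F' z h) \<le> L * lpnorm p (x - z)"
    and c: "c > 0"
      "\<And>x z. x \<in> lp p \<Longrightarrow> z \<in> lp p \<Longrightarrow> norm (F x - F z - F' z (x - z)) \<le> c * bregman p x z"
    and s: "s > 2" and \<rho>: "0 < \<rho>" "\<rho> < 1 / (s * c)"
    and xdag: "fp_minimizing_solution p F y xdag"
    and source: "norm \<omega> \<le> \<rho>" "duality_map p xdag = lp_adjoint p q (F' xdag) \<omega>"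
    and xmin: "\<And>\<alpha>. \<alpha> > 0 \<Longrightarrow> tikhonov_minimizer p F yd \<alpha> (xmin \<alpha>)"
    and \<alpha>s: "\<alpha>s = \<delta> / ((s - 2) * \<rho>)"
    and A: "A = (p / (2 * \<alpha>s)) powr (1 / p) * norm (F 0 - yd) powr (2 / p)"
    and K: "K = L * A + lp_opnorm p (F' 0)"
    and \<gamma>: "\<gamma> = (1 - s * c * \<rho>) / 2"
    and r: "\<And>\<alpha>. \<alpha> \<ge> \<alpha>s \<Longrightarrow> r \<alpha> = 2 / (1 + sqrt 2) *
        (if K = 0 then sqrt (\<gamma> * \<alpha> / (10 * c * L))
         else min (\<gamma> * \<alpha> / (3 * c * K)) (sqrt (\<gamma> * \<alpha> / (10 * c * L))))"
    and d: "continuous_on {\<alpha>s..} d" "strict_mono_on {\<alpha>s..} d" "filterlim d at_top at_top"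
      "\<And>\<alpha>. \<alpha> \<ge> \<alpha>s \<Longrightarrow> d \<alpha> > 0"
      "\<And>\<alpha>. \<alpha> \<ge> \<alpha>s \<Longrightarrow> bregman_ball p (xmin \<alpha>) (d \<alpha>) \<subseteq> lp_cball p (xmin \<alpha>) (r \<alpha>)"
    and \<alpha>j: "\<alpha>\<^sub>j \<ge> \<alpha>s"
    and grad: "grad = tikhonov_grad p q F F' yd \<alpha>\<^sub>j"
    and cA: "cA = (p - 1) / 2 * (2 * r \<alpha>\<^sub>j + A) powr (p - 2)"
    and cbar: "\<And>x. cbar x = min 1
        (8 * cA * (tikhonov p F yd \<alpha>\<^sub>j x - line_min p q F F' yd \<alpha>\<^sub>j x) /
          (4 * K\<^sup>2 + 4 * L * s * \<rho> * \<alpha>\<^sub>j + 4 * L * K * r \<alpha>\<^sub>j + L\<^sup>2 * (r \<alpha>\<^sub>j)\<^sup>2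
            + 8 * \<alpha>\<^sub>j * ct * cA powr ((2 - p) / 2)))"
    and \<beta>: "\<And>M x. \<beta> M x = min (\<gamma> * cbar x * \<alpha>\<^sub>j / (lpnorm q (grad x))\<^sup>2) (1 / (2 * M))"
  shows "\<exists>M>0. \<forall>x0 \<in> bregman_ball p (xmin \<alpha>\<^sub>j) (d \<alpha>\<^sub>j).
           lp_tendsto p (dual_iterates p q grad (\<beta> M) x0) (xmin \<alpha>\<^sub>j)"
proof -
  interpret conjugate_exponents p q
    using p q by unfold_locales
  have "\<alpha>s > 0"
    using \<delta> s \<rho>(1) unfolding \<alpha>s by simp
  then have pos: "\<alpha>s > 0" "\<alpha>\<^sub>j > 0"
    using \<alpha>j by linarith+
  interpret T: tikhonov_functional p q F F' yd L c ct \<alpha>\<^sub>j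
    using frechet L c ct pos(2) by unfold_locales
  note xmj = xmin[OF pos(2)]
  then have xm: "xmin \<alpha>\<^sub>j \<in> lp p"
    by (simp add: tikhonov_minimizer_def)
  have sc: "s * c > 0" using s c(1) by simp
  then have scr: "s * c * \<rho> < 1"
    using \<rho>(2) by (simp add: pos_less_divide_eq mult.commute)
  then have \<gamma>0: "\<gamma> > 0" by (simp add: \<gamma>)
  have A0: "A \<ge> 0" by (simp add: A)
  have K0: "K \<ge> 0"
    using L(1) A0 T.N_nonneg[OF lp_zero] by (simp add: K)
  define \<tau> where "\<tau> = 2 / (1 + sqrt 2)"
  define B1 B2 where "B1 = \<gamma> * \<alpha>\<^sub>j / (3 * c * K)" and "B2 = sqrt (\<gamma> * \<alpha>\<^sub>j / (10 * c * L))"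
  have \<tau>: "0 < \<tau>" "\<tau> \<le> 1"
    by (auto simp: \<tau>_def add_pos_nonneg divide_le_eq)
  have rj: "r \<alpha>\<^sub>j = \<tau> * (if K = 0 then B2 else min B1 B2)"
    using r[OF \<alpha>j] by (simp add: \<tau>_def B1_def B2_def)
  have B2: "B2 > 0"
    using \<gamma>0 pos c(1) L(1) by (simp add: B2_def)
  have B1: "B1 > 0" if "K \<noteq> 0"
    using \<gamma>0 pos c(1) K0 that by (simp add: B1_def)
  have r0: "r \<alpha>\<^sub>j > 0"
    unfolding rj using \<tau> B1 B2 by (intro mult_pos_pos) auto
  have "r \<alpha>\<^sub>j \<le> 1 * (if K = 0 then B2 else min B1 B2)"
    unfolding rj using \<tau> B1 B2 by (intro mult_right_mono) (auto intro: less_imp_le)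
  then have rB: "r \<alpha>\<^sub>j \<le> B2" "K \<noteq> 0 \<Longrightarrow> r \<alpha>\<^sub>j \<le> B1"
    by (auto split: if_splits)
  \<comment> \<open>The two entries of the minimum control the two summands of c (K + L r) r: the
    first is at most a third, the second a tenth of \<gamma> \<alpha>, so together they stay below
    \<gamma> \<alpha>.\<close>
  have rK: "c * K * r \<alpha>\<^sub>j \<le> \<gamma> * \<alpha>\<^sub>j / 3"
  proof (cases "K = 0")
    case False
    then have "c * K * r \<alpha>\<^sub>j \<le> c * K * B1"
      using rB(2) c(1) K0 by (intro mult_left_mono) auto
    also have "\<dots> = \<gamma> * \<alpha>\<^sub>j / 3"
      using False c(1) by (simp add: B1_def)
    finally show ?thesis .
  qed (use \<gamma>0 pos in simp)
  have "(r \<alpha>\<^sub>j)\<^sup>2 \<le> B2\<^sup>2"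
    using rB r0 by (intro power_mono) auto
  also have "\<dots> = \<gamma> * \<alpha>\<^sub>j / (10 * c * L)"
    using \<gamma>0 pos c(1) L(1) by (simp add: B2_def)
  finally have rL: "c * L * (r \<alpha>\<^sub>j)\<^sup>2 \<le> \<gamma> * \<alpha>\<^sub>j / 10"
    using c(1) L(1) by (simp add: pos_le_divide_eq mult_ac)
  have "c * ((K + L * r \<alpha>\<^sub>j) * r \<alpha>\<^sub>j) = c * K * r \<alpha>\<^sub>j + c * L * (r \<alpha>\<^sub>j)\<^sup>2"
    by (simp add: algebra_simps power2_eq_square)
  moreover have "0 < \<gamma> * \<alpha>\<^sub>j"
    using \<gamma>0 pos by simp
  ultimately have small: "c * ((K + L * r \<alpha>\<^sub>j) * r \<alpha>\<^sub>j) \<le> \<gamma> * \<alpha>\<^sub>j"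
    using rK rL by linarith
  have nA: "lpnorm p (xmin \<alpha>\<^sub>j) \<le> A"
    unfolding A by (rule T.minimizer_norm[OF xmj pos(1) \<alpha>j])
  then have "L * lpnorm p (xmin \<alpha>\<^sub>j) \<le> L * A"
    using L(1) by (intro mult_left_mono) auto
  then have NK: "lp_opnorm p (F' (xmin \<alpha>\<^sub>j)) \<le> K"
    using T.N_le[OF xm lp_zero] by (simp add: K)
  have xd: "xdag \<in> lp p" "F xdag = y"
    using xdag by (auto simp: fp_minimizing_solution_def)
  have "c * \<rho> \<le> s * c * \<rho>"
    using s c(1) \<rho>(1) by simp
  then have "norm (F (xmin \<alpha>\<^sub>j) - yd) \<le> \<delta> + 2 * \<alpha>\<^sub>j * \<rho>"
    using scr yd xd by (intro T.minimizer_residual[OF xmj xd(1) _ source]) auto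
  \<comment> \<open>The parameter bound says \<delta> \<le> (s - 2) \<rho> \<alpha>. Multiplied by
    c, the result has the factor s c \<rho> = 1 - 2 \<gamma>, which is where \<gamma> comes
    from.\<close>
  also have "\<dots> \<le> s * \<rho> * \<alpha>\<^sub>j"
    using \<alpha>j s \<rho>(1) by (simp add: \<alpha>s pos_divide_le_eq algebra_simps)
  finally have "c * norm (F (xmin \<alpha>\<^sub>j) - yd) \<le> c * (s * \<rho> * \<alpha>\<^sub>j)"
    using c(1) by (intro mult_left_mono) auto
  moreover have "1 - 2 * \<gamma> = s * c * \<rho>"
  proof -
    have "2 * (u / 2) = u" for u :: real
      by simp
    then show ?thesis
      by (simp only: \<gamma> diff_diff_eq2)
  qed
  ultimately have res: "c * norm (F (xmin \<alpha>\<^sub>j) - yd) \<le> (1 - 2 * \<gamma>) * \<alpha>\<^sub>j"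
    by (simp add: mult_ac)
  \<comment> \<open>The denominator in \<open>cbar\<close>; the summand 4 L s \<rho> \<alpha> alone
    makes it positive, the others being nonnegative.\<close>
  define den where "den = 4 * K\<^sup>2 + 4 * L * s * \<rho> * \<alpha>\<^sub>j + 4 * L * K * r \<alpha>\<^sub>j + L\<^sup>2 * (r \<alpha>\<^sub>j)\<^sup>2
            + 8 * \<alpha>\<^sub>j * ct * cA powr ((2 - p) / 2)"
  have den: "den > 0"
  proof -
    have "0 < 4 * L * s * \<rho> * \<alpha>\<^sub>j"
      using L(1) s \<rho>(1) pos by simp
    moreover have "0 \<le> 4 * L * K * r \<alpha>\<^sub>j"
      using L(1) K0 r0 by simp
    moreover have "0 \<le> 8 * \<alpha>\<^sub>j * ct * cA powr ((2 - p) / 2)"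
      using pos ct(1) by simp
    moreover have "0 \<le> 4 * K\<^sup>2" "0 \<le> L\<^sup>2 * (r \<alpha>\<^sub>j)\<^sup>2"
      by simp_all
    ultimately show ?thesis
      unfolding den_def by linarith
  qed
  have "2 * r \<alpha>\<^sub>j + A > 0"
    using r0 A0 by linarith
  then have cA0: "cA > 0"
    using p(1) unfolding cA by simp
  show ?thesis
    unfolding grad
  \<comment> \<open>The factor \<gamma> \<alpha> is both the convexity constant from
    \<open>local_convexity\<close> and the numerator of the step size; \<nu> collects what
    multiplies the line decrease in \<open>cbar\<close>.\<close>
  proof (rule T.dual_iteration_convergence[OF xmj r0, where \<mu> = "\<gamma> * \<alpha>\<^sub>j" and \<eta> = "\<gamma> * \<alpha>\<^sub>j" and \<nu> = "8 * cA / den"])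
    show "bregman_ball p (xmin \<alpha>\<^sub>j) (d \<alpha>\<^sub>j) \<subseteq> lp_cball p (xmin \<alpha>\<^sub>j) (r \<alpha>\<^sub>j)"
      by (rule d(5)[OF \<alpha>j])
    then show "tikhonov p F yd \<alpha>\<^sub>j x - tikhonov p F yd \<alpha>\<^sub>j (xmin \<alpha>\<^sub>j) + \<gamma> * \<alpha>\<^sub>j * bregman p (xmin \<alpha>\<^sub>j) x
        \<le> pairing (tikhonov_grad p q F F' yd \<alpha>\<^sub>j x) (x - xmin \<alpha>\<^sub>j)"
      if "x \<in> bregman_ball p (xmin \<alpha>\<^sub>j) (d \<alpha>\<^sub>j)" for x
      using that by (intro T.local_convexity[OF _ xm _ res NK small]) (auto simp: lp_cball_def)
    show "\<beta> M x = min (\<gamma> * \<alpha>\<^sub>j * min 1 (8 * cA / den *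
          (tikhonov p F yd \<alpha>\<^sub>j x - line_min p q F F' yd \<alpha>\<^sub>j x)) / (lpnorm q (tikhonov_grad p q F F' yd \<alpha>\<^sub>j x))\<^sup>2)
        (1 / (2 * M))" for M x
      unfolding \<beta> cbar den_def grad by (simp add: mult_ac)
  qed (use \<gamma>0 pos cA0 den in auto)
qed

end
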